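(* Let $w=(w(n))_{n\in\mathbb{N}}$ be a nonnegative weight sequence, let $\psi(n)=n/\phi_{\gamma_{1,w}}(n)$ for every $n\in\mathbb{N}$, and let $x\in S_{\gamma_{1,w}^*}$. Then $x$ is a smooth point in $B_{\gamma_{1,w}^*}$ if and only if there exists $n_0\in\mathbb{N}$ such that $$x^{**}(n_0)\psi(n_0)=1>\sup_{n\neq n_0}\{x^{**}(n)\psi(n)\}.$$
   Context: $\mathbb{N}$ is the set of positive integers and $\ell^0$ is the set of all real sequences. For $x\in\ell^0$ put $d_x(\lambda)=\operatorname{card}\{k\in\mathbb{N}:|x(k)|>\lambda\}$ for $\lambda\ge 0$, $x^*(n)=\inf\{\lambda\ge 0: d_x(\lambda)\le n-1\}$ (decreasing rearrangement) and $x^{**}(n)=\frac1n\sum_{i=1}^n x^*(i)$ for $n\in\mathbb{N}$. A nonnegative weight sequence is a sequence $w=(w(n))_{n\in\mathbb{N}}$ of nonnegative reals, with $w(n)>0$ for at least one $n$, such that $W_1(n)=n\sum_{i=n+1}^\infty \frac{w(i)}{i}<\infty$ for every $n\in\mathbb{N}$. Put $W(n)=\sum_{i=1}^n w(i)$ and $W(\infty)=\sum_{i=1}^\infty w(i)$. The sequence Lorentz space $\gamma_{1,w}$ is the Banach space of all $x\in\ell^0$ with $\|x\|_{\gamma_{1,w}}=\sum_{n=1}^\infty x^{**}(n) w(n)<\infty$; its fundamental sequence is $\phi_{\gamma_{1,w}}(n)=\|\chi_{\{i\in\mathbb{N}:i\le n\}}\|_{\gamma_{1,w}}=W(n)+W_1(n)$,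 and $\gamma_{1,w}^*$ is its dual space. Elements of $\gamma_{1,w}^*$ are regarded as sequences $y$ through the pairing $u\mapsto\sum_{n=1}^\infty u(n)y(n)$, $u\in\gamma_{1,w}$. (For reference: this pairing identifies $\gamma_{1,w}^*$ isometrically with the Marcinkiewicz space $m_\psi$ of all $y\in\ell^0$ with $\|y\|_{m_\psi}=\sup_{n\in\mathbb{N}} y^{**}(n)\psi(n)<\infty$ if and only if $W(\infty)=\infty$.) $S_X$ and $B_X$ denote the unit sphere and the closed unit ball of a Banach space $X$. An element $x\in X$ is a smooth point of $X$ (for $x\in S_X$, also called a smooth point in $B_X$) if there exists a unique bounded linear functional $f\in S_{X^*}$ with $f(x)=\|x\|_X$. *)

theory Defs
  imports "HOL-Analysis.Analysis" "HOL-Library.Extended_Nat"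
begin

text \<open>
  Sequences are indexed by the positive integers. A sequence is a function on \<^typ>\<open>nat\<close> that
  vanishes at the unused index 0, so that equal sequences are equal functions. For the weight
  \<open>w\<close>, the value \<open>w 0\<close> is never used.
\<close>

definition seqs :: "(nat \<Rightarrow> real) set" where
  "seqs = {x. x 0 = 0}"

definition ecard :: "'a set \<Rightarrow> enat" where
  "ecard A = (if finite A then enat (card A) else \<infinity>)"

definition distr :: "(nat \<Rightarrow> real) \<Rightarrow> real \<Rightarrow> enat" where
  "distr x l = ecard {k. 1 \<le> k \<and> \<bar>x k\<bar> > l}"

text \<open>The infimum is taken in \<open>[0, \<infinity>]\<close>: it is \<open>\<infinity>\<close> for an unbounded sequence.\<close>

definition rearr :: "(nat \<Rightarrow> real) \<Rightarrow> nat \<Rightarrow> ennreal" where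
  "rearr x n = (INF l\<in>{l. 0 \<le> l \<and> distr x l \<le> enat (n - 1)}. ennreal l)"

definition max_rearr :: "(nat \<Rightarrow> real) \<Rightarrow> nat \<Rightarrow> ennreal" where
  "max_rearr x n = (\<Sum>i=1..n. rearr x i) / of_nat n"

definition W1 :: "(nat \<Rightarrow> real) \<Rightarrow> nat \<Rightarrow> ennreal" where
  "W1 w n = of_nat n * (\<Sum>i. ennreal (w (n + 1 + i) / real (n + 1 + i)))"

definition nonneg_weight :: "(nat \<Rightarrow> real) \<Rightarrow> bool" where
  "nonneg_weight w \<longleftrightarrow>
     (\<forall>n\<ge>1. 0 \<le> w n) \<and> (\<exists>n\<ge>1. 0 < w n) \<and> (\<forall>n\<ge>1. W1 w n < \<infinity>)"

definition gamma_enorm :: "(nat \<Rightarrow> real) \<Rightarrow> (nat \<Rightarrow> real) \<Rightarrow> ennreal" where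
  "gamma_enorm w x = (\<Sum>n. max_rearr x (Suc n) * ennreal (w (Suc n)))"

definition gamma :: "(nat \<Rightarrow> real) \<Rightarrow> (nat \<Rightarrow> real) set" where
  "gamma w = {x \<in> seqs. gamma_enorm w x < \<infinity>}"

definition gamma_norm :: "(nat \<Rightarrow> real) \<Rightarrow> (nat \<Rightarrow> real) \<Rightarrow> real" where
  "gamma_norm w x = enn2real (gamma_enorm w x)"

definition fund_seq :: "(nat \<Rightarrow> real) \<Rightarrow> nat \<Rightarrow> ennreal" where
  "fund_seq w n = gamma_enorm w (indicator {1..n})"

definition psi :: "(nat \<Rightarrow> real) \<Rightarrow> nat \<Rightarrow> ennreal" where
  "psi w n = of_nat n / fund_seq w n"

text \<open>
  A normed space is given by a carrier \<open>V\<close>, a linear subspace of some space of real-valued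
  functions, and a norm \<open>N\<close> on \<open>V\<close>. Functionals on \<open>V\<close> are taken to be 0 outside \<open>V\<close>, so that
  they are determined by their values on \<open>V\<close> and \<open>dual V N\<close> with \<open>dual_norm V N\<close> is again
  a normed space of this form; the bidual is the dual of the dual.
\<close>

definition dual :: "('a \<Rightarrow> real) set \<Rightarrow> (('a \<Rightarrow> real) \<Rightarrow> real) \<Rightarrow> (('a \<Rightarrow> real) \<Rightarrow> real) set" where
  "dual V N = {f.
     (\<forall>u. u \<notin> V \<longrightarrow> f u = 0) \<and>
     (\<forall>u\<in>V. \<forall>v\<in>V. \<forall>a b. f (\<lambda>t. a * u t + b * v t) = a * f u + b * f v) \<and>
     (\<exists>C. \<forall>u\<in>V. \<bar>f u\<bar> \<le> C * N u)}"

definition dual_norm :: "('a \<Rightarrow> real) set \<Rightarrow> (('a \<Rightarrow> real) \<Rightarrow> real) \<Rightarrow> (('a \<Rightarrow> real) \<Rightarrow> real) \<Rightarrow> real" where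
  "dual_norm V N f = (SUP u\<in>{u\<in>V. N u \<le> 1}. \<bar>f u\<bar>)"

definition unit_sphere :: "('a \<Rightarrow> real) set \<Rightarrow> (('a \<Rightarrow> real) \<Rightarrow> real) \<Rightarrow> ('a \<Rightarrow> real) set" where
  "unit_sphere V N = {u\<in>V. N u = 1}"

definition smooth_point :: "('a \<Rightarrow> real) set \<Rightarrow> (('a \<Rightarrow> real) \<Rightarrow> real) \<Rightarrow> ('a \<Rightarrow> real) \<Rightarrow> bool" where
  "smooth_point V N x \<longleftrightarrow>
     x \<in> V \<and> (\<exists>!f. f \<in> unit_sphere (dual V N) (dual_norm V N) \<and> f x = N x)"

text \<open>The functional \<open>F\<close> on \<open>V\<close> is given by the sequence \<open>y\<close> through the pairing.\<close>

definition given_by :: "(nat \<Rightarrow> real) set \<Rightarrow> ((nat \<Rightarrow> real) \<Rightarrow> real) \<Rightarrow> (nat \<Rightarrow> real) \<Rightarrow> bool" where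
  "given_by V F y \<longleftrightarrow>
     y \<in> seqs \<and> (\<forall>u\<in>V. (\<lambda>n. u (Suc n) * y (Suc n)) sums F u)"

abbreviation gamma_dual :: "(nat \<Rightarrow> real) \<Rightarrow> ((nat \<Rightarrow> real) \<Rightarrow> real) set" where
  "gamma_dual w \<equiv> dual (gamma w) (gamma_norm w)"

abbreviation gamma_dual_norm :: "(nat \<Rightarrow> real) \<Rightarrow> ((nat \<Rightarrow> real) \<Rightarrow> real) \<Rightarrow> real" where
  "gamma_dual_norm w \<equiv> dual_norm (gamma w) (gamma_norm w)"

end

theory Submission
  imports Defs
begin

text \<open>
  Write \<open>T j = \<Sum>i>j. w i / i\<close>. Interchanging summations turns the norm of \<open>\<gamma>\<close> into
  \<open>\<Sum>n. u\<^sup>*(n + 1) T n\<close> with a decreasing weight \<open>T\<close> that tends to 0, and the fundamental sequence into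
  the concave sequence \<open>\<phi> n = \<Sum>j<n. T j\<close>. If \<open>S n\<close> denotes the sum of the \<open>n\<close> largest values of
  \<open>\<bar>x\<bar>\<close>, then \<open>x\<^sup>*\<^sup>*(n) \<psi>(n) = S n / \<phi> n\<close>, and the theorem says that \<open>F\<close> is smooth exactly when the
  ratio \<open>S n / \<phi> n\<close> attains its supremum 1 at one point only and stays away from 1 elsewhere.

  Every element of \<open>\<gamma>\<close> is a norm limit of positive combinations of nested sign patterns (sequences with
  values in \<open>{-1, 0, 1}\<close>) whose norms add up, so the norm of a functional is determined by its values
  on sign patterns (\<open>functional_le_if_le_on_signed\<close>). This holds for all functionals, also for those
  that no sequence represents; hence the cases \<open>W(\<infinity>) = \<infinity>\<close> and \<open>W(\<infinity>) < \<infinity>\<close> need no separate description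
  of the dual.

  Suppose that the ratio is 1 at \<open>n\<close> and at most \<open>q < 1\<close> elsewhere. Concavity of \<open>\<phi>\<close> forces a gap
  between the \<open>n\<close>-th and the next largest value of \<open>\<bar>x\<bar>\<close>, so one sign pattern \<open>v\<close> of length \<open>n\<close> norms
  \<open>F\<close> and \<open>F\<close> is bounded away from its norm on all others. Near \<open>F\<close> the dual norm is therefore
  the linear function \<open>H \<mapsto> H v / \<phi> n\<close>, which leaves one supporting functional
  (\<open>smooth_if_strict_maximum\<close>).

  Conversely, each sequence \<open>u\<^sub>k\<close> in the unit ball with \<open>F u\<^sub>k \<longlonglongrightarrow> 1\<close> gives a supporting functional at
  \<open>F\<close> as a generalized limit of the evaluations \<open>H \<mapsto> H u\<^sub>k\<close>. Two such sequences on which some \<open>H\<close>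
  has different limits disprove smoothness (\<open>not_smooth_if_two_norming_sequences\<close>). If the ratio is 1
  at two points, the two sign patterns are such constant sequences. Otherwise the ratio comes close to 1
  along arbitrarily large \<open>n\<close>. For unbounded \<open>\<phi>\<close>, sparse sign patterns live essentially on disjoint
  blocks and the restriction of \<open>F\<close> to every other block separates the even from the odd ones. For
  bounded \<open>\<phi>\<close>, the infinite sign pattern of \<open>x\<close> norms \<open>F\<close> as well, and a limit at infinity
  separates it from the finite ones.
\<close>

section \<open>Supporting functionals of a functional\<close>

text \<open>
  A Banach limit without shift invariance; the limit along a free ultrafilter is the typical example.
\<close>

definition limit_functional :: "((nat \<Rightarrow> real) \<Rightarrow> real) \<Rightarrow> bool" where
  "limit_functional L \<longleftrightarrow>
     (\<forall>s t a b. Bseq s \<longrightarrow> Bseq t \<longrightarrow> L (\<lambda>n. a * s n + b * t n) = a * L s + b * L t) \<and>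
     (\<forall>s C. (\<forall>n. \<bar>s n\<bar> \<le> C) \<longrightarrow> \<bar>L s\<bar> \<le> C) \<and>
     (\<forall>s l. s \<longlonglongrightarrow> l \<longrightarrow> L s = l)"

lemma Bseq_linear_combination:
  fixes s t :: "nat \<Rightarrow> real"
  assumes "Bseq s" "Bseq t"
  shows "Bseq (\<lambda>n. a * s n + b * t n)"
proof -
  obtain C D where C: "\<And>n. \<bar>s n\<bar> \<le> C" and D: "\<And>n. \<bar>t n\<bar> \<le> D"
    using assms by (auto simp: Bseq_def)
  have "\<bar>a * s n + b * t n\<bar> \<le> \<bar>a\<bar> * C + \<bar>b\<bar> * D" for n
    using abs_triangle_ineq[of "a * s n" "b * t n"] C[of n] D[of n]
      mult_left_mono[OF C[of n], of "\<bar>a\<bar>"] mult_left_mono[OF D[of n], of "\<bar>b\<bar>"]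
    by (simp add: abs_mult)
  then show ?thesis by (intro BseqI'[of _ "\<bar>a\<bar> * C + \<bar>b\<bar> * D"]) auto
qed

text \<open>
  The evaluations \<open>s \<mapsto> s n\<close> on bounded sequences lie in a product of compact intervals, so by
  Tychonoff's theorem they have a cluster point, and the three properties pass to it.
\<close>

lemma limit_functional_exists: "\<exists>L. limit_functional L"
proof -
  \<comment> \<open>Unbounded sequences are sent to 0 so that every coordinate ranges over a compact set.\<close>
  define p :: "nat \<Rightarrow> (nat \<Rightarrow> real) \<Rightarrow> real" where "p n s = (if Bseq s then s n else 0)" for n s
  define K :: "(nat \<Rightarrow> real) \<Rightarrow> real set"
    where "K s = (if Bseq s then {- (SUP n. \<bar>s n\<bar>)..(SUP n. \<bar>s n\<bar>)} else {0})" for s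
  have "compactin (product_topology (\<lambda>_. euclidean) UNIV) (PiE UNIV K)"
    by (subst compactin_PiE) (auto simp: K_def)
  then have cpt: "compact (PiE UNIV K)"
    by (simp add: euclidean_product_topology)
  have bdd: "bdd_above (range (\<lambda>n. \<bar>s n\<bar>))" if "Bseq s" for s :: "nat \<Rightarrow> real"
    using that by (force simp: Bseq_def bdd_above_def)
  have "p n s \<in> K s" for n s
  proof (cases "Bseq s")
    case True
    then have "\<bar>s n\<bar> \<le> (SUP n. \<bar>s n\<bar>)" by (intro cSUP_upper bdd) auto
    then show ?thesis using True by (auto simp: p_def K_def)
  qed (auto simp: p_def K_def)
  then have "p n \<in> PiE UNIV K" for n by auto
  then have "eventually (\<lambda>f. f \<in> PiE UNIV K) (filtermap p sequentially)"
    by (simp add: eventually_filtermap)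
  moreover have "filtermap p sequentially \<noteq> bot" by (simp add: filtermap_bot_iff)
  ultimately obtain L where L: "inf (nhds L) (filtermap p sequentially) \<noteq> bot"
    using cpt unfolding compact_filter by blast
  \<comment> \<open>Three coordinates at a time are enough for linearity.\<close>
  have frq: "\<exists>n. P n \<and> (\<forall>s\<in>{r, s, t}. \<bar>L s - p n s\<bar> < e)"
    if e: "e > 0" and P: "eventually P sequentially" for e r s t P
  proof (rule ccontr)
    assume no: "\<not> ?thesis"
    have "eventually (\<lambda>f. \<bar>L s - f s\<bar> < e) (nhds L)" for s
    proof -
      have "open {f :: (nat \<Rightarrow> real) \<Rightarrow> real. \<bar>L s - f s\<bar> < e}"
        by (intro open_Collect_less continuous_intros) (auto intro!: continuous_on_product_coordinates)
      from eventually_nhds_in_open[OF this, of L] show ?thesis using e by simp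
    qed
    then have 1: "eventually (\<lambda>f. \<forall>s\<in>{r, s, t}. \<bar>L s - f s\<bar> < e) (nhds L)"
      by (simp add: eventually_conj_iff)
    have "eventually (\<lambda>f. \<not> (\<forall>s\<in>{r, s, t}. \<bar>L s - f s\<bar> < e)) (filtermap p sequentially)"
      unfolding eventually_filtermap using P by eventually_elim (use no in blast)
    then have "eventually (\<lambda>_. False) (inf (nhds L) (filtermap p sequentially))"
      unfolding eventually_inf using 1 by blast
    then show False using L by (simp add: trivial_limit_def)
  qed
  have "limit_functional L"
    unfolding limit_functional_def
  proof (intro conjI allI impI)
    fix s t :: "nat \<Rightarrow> real" and a b assume st: "Bseq s" "Bseq t"
    let ?r = "\<lambda>n. a * s n + b * t n"
    have r: "Bseq ?r" using st by (rule Bseq_linear_combination)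
    have "\<bar>L ?r - (a * L s + b * L t)\<bar> \<le> 0"
    proof (rule field_le_epsilon)
      fix e :: real assume e: "e > 0"
      define d where "d = e / (1 + \<bar>a\<bar> + \<bar>b\<bar>)"
      have d: "d > 0" using e by (auto simp: d_def intro!: divide_pos_pos)
      obtain n where n: "\<bar>L ?r - ?r n\<bar> < d" "\<bar>L s - s n\<bar> < d" "\<bar>L t - t n\<bar> < d"
        using frq[OF d, of "\<lambda>_. True" ?r s t] r st by (auto simp: p_def)
      have "L ?r - (a * L s + b * L t) = (L ?r - ?r n) - a * (L s - s n) - b * (L t - t n)"
        by (simp add: algebra_simps)
      also have "\<bar>\<dots>\<bar> \<le> \<bar>L ?r - ?r n\<bar> + \<bar>a\<bar> * \<bar>L s - s n\<bar> + \<bar>b\<bar> * \<bar>L t - t n\<bar>"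
        unfolding abs_mult[symmetric] by linarith
      also have "\<dots> \<le> d + \<bar>a\<bar> * d + \<bar>b\<bar> * d" using n by (intro add_mono mult_left_mono) auto
      also have "\<dots> = d * (1 + \<bar>a\<bar> + \<bar>b\<bar>)" by (simp add: algebra_simps)
      also have "\<dots> = e" unfolding d_def by (simp add: add_nonneg_eq_0_iff add_eq_0_iff_both_eq_0)
      finally show "\<bar>L ?r - (a * L s + b * L t)\<bar> \<le> 0 + e" by simp
    qed
    then show "L ?r = a * L s + b * L t" by simp
  next
    fix s :: "nat \<Rightarrow> real" and C assume C: "\<forall>n. \<bar>s n\<bar> \<le> C"
    then have s: "Bseq s" by (auto intro!: BseqI'[of _ C])
    show "\<bar>L s\<bar> \<le> C"
    proof (rule field_le_epsilon)
      fix e :: real assume "e > 0"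
      then obtain n where "\<bar>L s - s n\<bar> < e"
        using frq[of e "\<lambda>_. True" s s s] s by (auto simp: p_def)
      then show "\<bar>L s\<bar> \<le> C + e" using C[rule_format, of n] by linarith
    qed
  next
    fix s :: "nat \<Rightarrow> real" and l assume l: "s \<longlonglongrightarrow> l"
    then have s: "Bseq s" by (intro convergent_imp_Bseq convergentI)
    have "\<bar>L s - l\<bar> \<le> 0"
    proof (rule field_le_epsilon)
      fix e :: real assume e: "e > 0"
      then have "eventually (\<lambda>n. dist (s n) l < e / 2) sequentially"
        using l by (intro tendstoD) auto
      then obtain n where "\<bar>L s - s n\<bar> < e / 2" "dist (s n) l < e / 2"
        using frq[of "e / 2" "\<lambda>n. dist (s n) l < e / 2" s s s] s e by (auto simp: p_def)
      then show "\<bar>L s - l\<bar> \<le> 0 + e" unfolding dist_real_def by linarith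
    qed
    then show "L s = l" by simp
  qed
  then show ?thesis by blast
qed

text \<open>
  Functionals are normed over the unit ball, so homogeneity of \<open>N\<close> gives \<open>\<bar>f u\<bar> \<le> dual_norm V N f * N u\<close>. The
  dual is again such a space, so that all facts apply to the bidual as well.
\<close>

locale homogeneous_space =
  fixes V :: "('a \<Rightarrow> real) set" and N :: "('a \<Rightarrow> real) \<Rightarrow> real"
  assumes zero_mem: "(\<lambda>_. 0) \<in> V"
    and comb_mem: "u \<in> V \<Longrightarrow> v \<in> V \<Longrightarrow> (\<lambda>t. a * u t + b * v t) \<in> V"
    and N_nonneg: "u \<in> V \<Longrightarrow> 0 \<le> N u"
    and N_scale: "u \<in> V \<Longrightarrow> N (\<lambda>t. c * u t) = \<bar>c\<bar> * N u"
begin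

lemma scale_mem: "u \<in> V \<Longrightarrow> (\<lambda>t. c * u t) \<in> V"
  using comb_mem[of u u c 0] by simp

lemma N_zero: "N (\<lambda>_. 0) = 0"
  using N_scale[OF zero_mem, of 0] by simp

lemma dual_comb:
  "f \<in> dual V N \<Longrightarrow> u \<in> V \<Longrightarrow> v \<in> V \<Longrightarrow> f (\<lambda>t. a * u t + b * v t) = a * f u + b * f v"
  by (auto simp: dual_def)

lemma dual_scale: "f \<in> dual V N \<Longrightarrow> u \<in> V \<Longrightarrow> f (\<lambda>t. c * u t) = c * f u"
  using dual_comb[of f u u c 0] by simp

lemma dual_sum:
  assumes "f \<in> dual V N" "finite J" "\<And>j. j \<in> J \<Longrightarrow> v j \<in> V"
  shows "(\<lambda>t. \<Sum>j\<in>J. v j t) \<in> V \<and> f (\<lambda>t. \<Sum>j\<in>J. v j t) = (\<Sum>j\<in>J. f (v j))"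
  using assms(2,3)
proof (induction rule: finite_induct)
  case empty
  then show ?case using zero_mem dual_scale[OF assms(1) zero_mem, of 0] by simp
next
  case (insert j J)
  then show ?case
    using comb_mem[of "v j" "\<lambda>t. \<Sum>j\<in>J. v j t" 1 1] dual_comb[OF assms(1), of "v j" "\<lambda>t. \<Sum>j\<in>J. v j t" 1 1]
    by simp
qed

lemma dual_bdd_above:
  assumes "f \<in> dual V N"
  shows "bdd_above ((\<lambda>u. \<bar>f u\<bar>) ` {u\<in>V. N u \<le> 1})"
proof -
  obtain C where C: "\<forall>u\<in>V. \<bar>f u\<bar> \<le> C * N u" using assms by (auto simp: dual_def)
  have "\<bar>f u\<bar> \<le> \<bar>C\<bar>" if "u \<in> V" "N u \<le> 1" for u
  proof -
    have "C * N u \<le> \<bar>C\<bar> * 1" using that N_nonneg by (intro mult_mono) auto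
    then show ?thesis using C that by force
  qed
  then show ?thesis by (auto simp: bdd_above_def)
qed

lemma abs_le_dual_norm:
  assumes "f \<in> dual V N" "u \<in> V"
  shows "\<bar>f u\<bar> \<le> dual_norm V N f * N u"
proof (cases "N u = 0")
  case True
  obtain C where "\<bar>f u\<bar> \<le> C * N u" using assms by (auto simp: dual_def)
  then show ?thesis using True by simp
next
  case False
  then have pos: "N u > 0" using N_nonneg assms(2) by force
  let ?v = "\<lambda>t. inverse (N u) * u t"
  have v: "?v \<in> V" "N ?v \<le> 1" using assms(2) pos by (auto simp: scale_mem N_scale)
  have "\<bar>f ?v\<bar> \<le> dual_norm V N f"
    unfolding dual_norm_def using v by (intro cSUP_upper dual_bdd_above assms) auto
  then have "inverse (N u) * \<bar>f u\<bar> \<le> dual_norm V N f"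
    using pos by (simp add: dual_scale[OF assms] abs_mult)
  then show ?thesis using pos by (simp add: field_simps)
qed

lemma dual_norm_leI:
  assumes "0 \<le> K" "\<And>u. u \<in> V \<Longrightarrow> \<bar>f u\<bar> \<le> K * N u"
  shows "dual_norm V N f \<le> K"
  unfolding dual_norm_def
proof (rule cSUP_least)
  show "{u \<in> V. N u \<le> 1} \<noteq> {}" using zero_mem N_zero by force
next
  fix u assume "u \<in> {u \<in> V. N u \<le> 1}"
  then have "u \<in> V" "K * N u \<le> K * 1" using assms(1) by (blast, intro mult_left_mono) auto
  then show "\<bar>f u\<bar> \<le> K" using assms(2)[of u] by linarith
qed

lemma dual_norm_nonneg:
  assumes "f \<in> dual V N" shows "0 \<le> dual_norm V N f"
proof -
  have "\<bar>f (\<lambda>_. 0)\<bar> \<le> dual_norm V N f"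
    unfolding dual_norm_def using zero_mem N_zero by (intro cSUP_upper dual_bdd_above assms) auto
  then show ?thesis by linarith
qed

lemma dual_comb_mem:
  assumes f: "f \<in> dual V N" and g: "g \<in> dual V N"
  shows "(\<lambda>u. a * f u + b * g u) \<in> dual V N"
proof -
  have "\<bar>a * f u + b * g u\<bar> \<le> (\<bar>a\<bar> * dual_norm V N f + \<bar>b\<bar> * dual_norm V N g) * N u" if "u \<in> V" for u
  proof -
    have "\<bar>a * f u + b * g u\<bar> \<le> \<bar>a\<bar> * \<bar>f u\<bar> + \<bar>b\<bar> * \<bar>g u\<bar>"
      using abs_triangle_ineq[of "a * f u" "b * g u"] by (simp add: abs_mult)
    also have "\<dots> \<le> \<bar>a\<bar> * (dual_norm V N f * N u) + \<bar>b\<bar> * (dual_norm V N g * N u)"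
      using that f g by (intro add_mono mult_left_mono abs_le_dual_norm) auto
    finally show ?thesis by (simp add: algebra_simps)
  qed
  then show ?thesis
    using f g unfolding dual_def mem_Collect_eq
    by (intro conjI exI[of _ "\<bar>a\<bar> * dual_norm V N f + \<bar>b\<bar> * dual_norm V N g"])
      (auto simp: dual_def algebra_simps)
qed

lemma homogeneous_space_dual: "homogeneous_space (dual V N) (dual_norm V N)"
proof
  show "(\<lambda>_. 0) \<in> dual V N" by (auto simp: dual_def intro!: exI[of _ 0])
next
  fix f c assume f: "f \<in> dual V N"
  have le: "dual_norm V N (\<lambda>t. c * g t) \<le> \<bar>c\<bar> * dual_norm V N g" if g: "g \<in> dual V N" for c g
  proof (rule dual_norm_leI)
    fix u assume "u \<in> V"
    then have "\<bar>c\<bar> * \<bar>g u\<bar> \<le> \<bar>c\<bar> * (dual_norm V N g * N u)"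
      using g by (intro mult_left_mono abs_le_dual_norm) auto
    then show "\<bar>c * g u\<bar> \<le> \<bar>c\<bar> * dual_norm V N g * N u" by (simp add: abs_mult mult.assoc)
  qed (use g dual_norm_nonneg in auto)
  have cf: "(\<lambda>t. c * f t) \<in> dual V N" using dual_comb_mem[OF f f, of c 0] by simp
  show "dual_norm V N (\<lambda>t. c * f t) = \<bar>c\<bar> * dual_norm V N f"
  proof (cases "c = 0")
    case True
    then show ?thesis using le[OF f, of 0] dual_norm_nonneg[OF cf] by simp
  next
    case False
    have "dual_norm V N f \<le> \<bar>inverse c\<bar> * dual_norm V N (\<lambda>t. c * f t)"
      using le[OF cf, of "inverse c"] False by (simp add: mult.assoc[symmetric])
    then show ?thesis using le[OF f, of c] False by (auto simp: field_simps abs_inverse intro!: antisym)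
  qed
qed (use dual_comb_mem dual_norm_nonneg in auto)

lemma unit_sphere_dualI:
  assumes "x \<in> V" "N x = 1" "f \<in> dual V N" "\<And>u. u \<in> V \<Longrightarrow> \<bar>f u\<bar> \<le> N u" "f x = 1"
  shows "f \<in> unit_sphere (dual V N) (dual_norm V N)"
proof -
  have "dual_norm V N f \<le> 1" using assms(4) by (intro dual_norm_leI) auto
  moreover have "1 \<le> dual_norm V N f" using abs_le_dual_norm[OF assms(3,1)] assms by simp
  ultimately show ?thesis using assms(3) by (simp add: unit_sphere_def)
qed

text \<open>
  The functional is the generalized limit of the evaluations along the norming sequence. Constant sequences
  give the evaluation at a norming vector.
\<close>

lemma norming_sequence_support:
  assumes F: "F \<in> unit_sphere (dual V N) (dual_norm V N)"
    and v: "\<And>k. v k \<in> V" "\<And>k. N (v k) \<le> 1" and lim: "(\<lambda>k. F (v k)) \<longlonglongrightarrow> 1"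
  obtains G where "G \<in> unit_sphere (dual (dual V N) (dual_norm V N)) (dual_norm (dual V N) (dual_norm V N))"
    and "G F = 1"
    and "\<And>H a. H \<in> dual V N \<Longrightarrow> (\<lambda>k. H (v k)) \<longlonglongrightarrow> a \<Longrightarrow> G H = a"
proof -
  let ?D = "dual V N" and ?M = "dual_norm V N"
  interpret D: homogeneous_space ?D ?M by (rule homogeneous_space_dual)
  obtain L where "limit_functional L" using limit_functional_exists by blast
  note L = this[unfolded limit_functional_def, THEN conjunct1, rule_format]
    this[unfolded limit_functional_def, THEN conjunct2, THEN conjunct1, rule_format]
    this[unfolded limit_functional_def, THEN conjunct2, THEN conjunct2, rule_format]
  define G where "G H = (if H \<in> ?D then L (\<lambda>k. H (v k)) else 0)" for H
  have bd: "\<bar>H (v k)\<bar> \<le> ?M H" if "H \<in> ?D" for H k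
    using abs_le_dual_norm[OF that v(1)[of k]] mult_left_mono[OF v(2)[of k] dual_norm_nonneg[OF that]] by simp
  then have bs: "Bseq (\<lambda>k. H (v k))" if "H \<in> ?D" for H
    using that by (intro BseqI'[of _ "?M H"]) auto
  have G_le: "\<bar>G H\<bar> \<le> ?M H" if "H \<in> ?D" for H using bd that by (auto simp: G_def intro!: L(2))
  have "G (\<lambda>t. a * H t + b * K t) = a * G H + b * G K" if "H \<in> ?D" "K \<in> ?D" for a b H K
    using that by (simp add: G_def D.comb_mem L(1)[OF bs bs])
  moreover have "G H = 0" if "H \<notin> ?D" for H using that by (simp add: G_def)
  ultimately have "G \<in> dual ?D ?M" unfolding dual_def[of ?D ?M] using G_le by (auto intro!: exI[of _ 1])
  moreover have F': "F \<in> ?D" "?M F = 1" using F by (auto simp: unit_sphere_def)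
  moreover have "G F = 1" using lim F' by (simp add: G_def L(3))
  ultimately show ?thesis
    using that[of G] D.unit_sphere_dualI[of F G] G_le by (simp add: G_def L(3))
qed

lemma not_smooth_if_two_norming_sequences:
  assumes F: "F \<in> unit_sphere (dual V N) (dual_norm V N)"
    and u: "\<And>k. u k \<in> V" "\<And>k. N (u k) \<le> 1" "(\<lambda>k. F (u k)) \<longlonglongrightarrow> 1"
    and v: "\<And>k. v k \<in> V" "\<And>k. N (v k) \<le> 1" "(\<lambda>k. F (v k)) \<longlonglongrightarrow> 1"
    and H: "H \<in> dual V N" "(\<lambda>k. H (u k)) \<longlonglongrightarrow> a" "(\<lambda>k. H (v k)) \<longlonglongrightarrow> b" "a \<noteq> b"
  shows "\<not> smooth_point (dual V N) (dual_norm V N) F"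
proof -
  obtain G where G: "G \<in> unit_sphere (dual (dual V N) (dual_norm V N)) (dual_norm (dual V N) (dual_norm V N))"
    "G F = 1" "G H = a"
    using norming_sequence_support[OF F u] H by metis
  obtain G' where G': "G' \<in> unit_sphere (dual (dual V N) (dual_norm V N)) (dual_norm (dual V N) (dual_norm V N))"
    "G' F = 1" "G' H = b"
    using norming_sequence_support[OF F v] H by metis
  have "dual_norm V N F = 1" using F by (simp add: unit_sphere_def)
  then show ?thesis using G G' H(4) unfolding smooth_point_def by metis
qed

text \<open>
  Let \<open>G\<close> support \<open>F\<close>. Since \<open>1 + s * G H = G (F + s * H)\<close> is at most the norm of \<open>F + s * H\<close>, the bound
  gives \<open>s * G H \<le> s * H v\<close> for a positive and a negative \<open>s\<close>, so \<open>G\<close> is the evaluation at \<open>v\<close>.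
\<close>

lemma smooth_if_locally_linear_bound:
  assumes F: "F \<in> unit_sphere (dual V N) (dual_norm V N)"
    and v: "v \<in> V" "N v \<le> 1" "F v = 1"
    and le: "\<And>H. H \<in> dual V N \<Longrightarrow> \<exists>t>0. \<forall>s\<in>{t, - t}. dual_norm V N (\<lambda>u. F u + s * H u) \<le> 1 + s * H v"
  shows "smooth_point (dual V N) (dual_norm V N) F"
proof -
  let ?D = "dual V N" and ?M = "dual_norm V N"
  interpret D: homogeneous_space ?D ?M by (rule homogeneous_space_dual)
  have F': "F \<in> ?D" "?M F = 1" using F by (auto simp: unit_sphere_def)
  obtain G0 where G0: "G0 \<in> unit_sphere (dual ?D ?M) (dual_norm ?D ?M)" "G0 F = 1"
    using v by (auto intro: norming_sequence_support[OF F, of "\<lambda>_. v"])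
  have eq: "G H = H v"
    if G: "G \<in> unit_sphere (dual ?D ?M) (dual_norm ?D ?M)" "G F = 1" and H: "H \<in> ?D" for G H
  proof -
    have G': "G \<in> dual ?D ?M" "dual_norm ?D ?M G = 1" using G by (auto simp: unit_sphere_def)
    obtain t where t: "t > 0" "\<And>s. s \<in> {t, - t} \<Longrightarrow> ?M (\<lambda>u. F u + s * H u) \<le> 1 + s * H v"
      using le[OF H] by blast
    have "s * G H \<le> s * H v" if "s \<in> {t, - t}" for s
    proof -
      have "1 + s * G H = G (\<lambda>u. F u + s * H u)"
        using D.dual_comb[OF G'(1) F'(1) H, of 1 s] G(2) by simp
      also have "\<dots> \<le> ?M (\<lambda>u. F u + s * H u)"
        using D.abs_le_dual_norm[OF G'(1) D.comb_mem[OF F'(1) H, of 1 s]] G'(2) by simp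
      also have "\<dots> \<le> 1 + s * H v" using t(2) that .
      finally show ?thesis by simp
    qed
    from this[of t] this[of "- t"] show ?thesis using t(1) by simp
  qed
  have "G = G0" if G: "G \<in> unit_sphere (dual ?D ?M) (dual_norm ?D ?M)" "G F = 1" for G
  proof
    fix H
    show "G H = G0 H"
    proof (cases "H \<in> ?D")
      case False
      moreover have "G \<in> dual ?D ?M" "G0 \<in> dual ?D ?M" using G G0 by (auto simp: unit_sphere_def)
      ultimately show ?thesis unfolding dual_def[of ?D ?M] by auto
    qed (simp add: eq[OF G] eq[OF G0])
  qed
  then show ?thesis unfolding smooth_point_def using F' G0 by auto
qed

end

section \<open>Decreasing rearrangements\<close>

lemma distr_le_iff: "distr u l \<le> enat n \<longleftrightarrow> finite {k. 1 \<le> k \<and> \<bar>u k\<bar> > l} \<and> card {k. 1 \<le> k \<and> \<bar>u k\<bar> > l} \<le> n"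
  by (auto simp: distr_def ecard_def)

lemma rearr_le:
  assumes "0 \<le> l" "finite {k. 1 \<le> k \<and> \<bar>u k\<bar> > l}" "card {k. 1 \<le> k \<and> \<bar>u k\<bar> > l} \<le> n"
  shows "rearr u (Suc n) \<le> ennreal l"
  unfolding rearr_def using assms by (intro INF_lower) (auto simp: distr_le_iff)

lemma le_rearr:
  assumes "\<And>l. 0 \<le> l \<Longrightarrow> finite {k. 1 \<le> k \<and> \<bar>u k\<bar> > l} \<Longrightarrow> card {k. 1 \<le> k \<and> \<bar>u k\<bar> > l} \<le> n \<Longrightarrow> c \<le> ennreal l"
  shows "c \<le> rearr u (Suc n)"
  unfolding rearr_def using assms by (intro INF_greatest) (auto simp: distr_le_iff)

lemma rearr_ge_if_card:
  assumes E: "finite E" "Suc n \<le> card E" "0 \<notin> E" "\<And>k. k \<in> E \<Longrightarrow> c \<le> \<bar>u k\<bar>"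
  shows "ennreal c \<le> rearr u (Suc n)"
proof (rule le_rearr)
  fix l :: real
  assume l: "0 \<le> l" "finite {k. 1 \<le> k \<and> \<bar>u k\<bar> > l}" "card {k. 1 \<le> k \<and> \<bar>u k\<bar> > l} \<le> n"
  have "c \<le> l"
  proof (rule ccontr)
    assume "\<not> c \<le> l"
    then have "E \<subseteq> {k. 1 \<le> k \<and> \<bar>u k\<bar> > l}" using E(3,4) by (force simp: Suc_le_eq intro: gr0I)
    from card_mono[OF l(2) this] show False using E(2) l(3) by simp
  qed
  then show "ennreal c \<le> ennreal l" by (rule ennreal_leI)
qed

lemma rearr_mono:
  assumes "\<And>k. 1 \<le> k \<Longrightarrow> \<bar>u k\<bar> \<le> \<bar>v k\<bar>"
  shows "rearr u (Suc n) \<le> rearr v (Suc n)"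
proof (rule le_rearr)
  fix l :: real
  assume l: "0 \<le> l" "finite {k. 1 \<le> k \<and> \<bar>v k\<bar> > l}" "card {k. 1 \<le> k \<and> \<bar>v k\<bar> > l} \<le> n"
  have "{k. 1 \<le> k \<and> \<bar>u k\<bar> > l} \<subseteq> {k. 1 \<le> k \<and> \<bar>v k\<bar> > l}" using assms by fastforce
  then show "rearr u (Suc n) \<le> ennreal l"
    using l card_mono[OF l(2)] finite_subset[OF _ l(2)] by (intro rearr_le) (auto intro: order_trans)
qed

lemma rearr_scale_le: "rearr (\<lambda>k. c * u k) (Suc n) \<le> ennreal \<bar>c\<bar> * rearr u (Suc n)"
proof (cases "c = 0")
  case True
  then show ?thesis using rearr_le[of 0 "\<lambda>k. c * u k" n] by simp
next
  case False
  have "inverse (ennreal \<bar>c\<bar>) * rearr (\<lambda>k. c * u k) (Suc n) \<le> rearr u (Suc n)"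
  proof (rule le_rearr)
    fix l :: real
    assume l: "0 \<le> l" "finite {k. 1 \<le> k \<and> \<bar>u k\<bar> > l}" "card {k. 1 \<le> k \<and> \<bar>u k\<bar> > l} \<le> n"
    have "{k. 1 \<le> k \<and> \<bar>c * u k\<bar> > \<bar>c\<bar> * l} = {k. 1 \<le> k \<and> \<bar>u k\<bar> > l}"
      using False by (auto simp: abs_mult)
    then have "rearr (\<lambda>k. c * u k) (Suc n) \<le> ennreal (\<bar>c\<bar> * l)"
      using l by (intro rearr_le) auto
    then have "inverse (ennreal \<bar>c\<bar>) * rearr (\<lambda>k. c * u k) (Suc n) \<le> inverse (ennreal \<bar>c\<bar>) * ennreal (\<bar>c\<bar> * l)"
      by (rule mult_left_mono) simp
    also have "\<dots> = ennreal l"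
      using False l(1) by (simp add: inverse_ennreal ennreal_mult[symmetric] mult.assoc[symmetric])
    finally show "inverse (ennreal \<bar>c\<bar>) * rearr (\<lambda>k. c * u k) (Suc n) \<le> ennreal l" .
  qed
  then have "ennreal \<bar>c\<bar> * (inverse (ennreal \<bar>c\<bar>) * rearr (\<lambda>k. c * u k) (Suc n)) \<le> ennreal \<bar>c\<bar> * rearr u (Suc n)"
    by (rule mult_left_mono) simp
  moreover have "ennreal \<bar>c\<bar> * inverse (ennreal \<bar>c\<bar>) = 1"
    using False by (simp add: inverse_ennreal ennreal_mult[symmetric])
  ultimately show ?thesis by (simp add: mult.assoc[symmetric])
qed

lemma rearr_scale: "rearr (\<lambda>k. c * u k) (Suc n) = ennreal \<bar>c\<bar> * rearr u (Suc n)"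
proof (cases "c = 0")
  case True
  then show ?thesis using rearr_scale_le[of c u n] by simp
next
  case False
  have "rearr u (Suc n) \<le> ennreal \<bar>inverse c\<bar> * rearr (\<lambda>k. c * u k) (Suc n)"
    using rearr_scale_le[of "inverse c" "\<lambda>k. c * u k" n] False by (simp add: mult.assoc[symmetric])
  then have "ennreal \<bar>c\<bar> * rearr u (Suc n) \<le> ennreal \<bar>c\<bar> * (ennreal \<bar>inverse c\<bar> * rearr (\<lambda>k. c * u k) (Suc n))"
    by (rule mult_left_mono) simp
  also have "\<dots> = rearr (\<lambda>k. c * u k) (Suc n)"
    using False by (simp add: mult.assoc[symmetric] ennreal_mult[symmetric] abs_mult[symmetric])
  finally show ?thesis using rearr_scale_le[of c u n] by (intro antisym)
qed

text \<open>
  If \<open>\<bar>u\<bar>\<close> exceeds \<open>l\<close> at most \<open>n\<close> times and \<open>\<bar>v\<bar>\<close> exceeds \<open>l'\<close> at most \<open>n\<close> times, then \<open>\<bar>u + v\<bar>\<close> exceeds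
  \<open>l + l'\<close> at most \<open>2 n\<close> times.
\<close>

lemma rearr_add_le:
  assumes "2 * n \<le> m"
  shows "rearr (\<lambda>k. u k + v k) (Suc m) \<le> rearr u (Suc n) + rearr v (Suc n)"
proof -
  let ?S = "\<lambda>u l. {k. 1 \<le> k \<and> \<bar>u k\<bar> > (l :: real)}"
  have *: "rearr (\<lambda>k. u k + v k) (Suc m) \<le> ennreal l + ennreal l'"
    if l: "0 \<le> l" "finite (?S u l)" "card (?S u l) \<le> n"
      and l': "0 \<le> l'" "finite (?S v l')" "card (?S v l') \<le> n" for l l'
  proof -
    have sub: "?S (\<lambda>k. u k + v k) (l + l') \<subseteq> ?S u l \<union> ?S v l'" by auto
    have "card (?S (\<lambda>k. u k + v k) (l + l')) \<le> card (?S u l \<union> ?S v l')"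
      using l l' sub by (intro card_mono) auto
    also have "\<dots> \<le> m" using card_Un_le[of "?S u l" "?S v l'"] l l' assms by linarith
    finally have "rearr (\<lambda>k. u k + v k) (Suc m) \<le> ennreal (l + l')"
      using l l' sub by (intro rearr_le) (auto intro: finite_subset)
    then show ?thesis using l l' by simp
  qed
  show ?thesis
  proof (cases "rearr u (Suc n) = top")
    case False
    have "rearr (\<lambda>k. u k + v k) (Suc m) - ennreal l' \<le> rearr u (Suc n)"
      if "0 \<le> l'" "finite (?S v l')" "card (?S v l') \<le> n" for l'
      by (rule le_rearr) (use * that in \<open>simp add: ennreal_minus_le_iff add.commute\<close>)
    then have "rearr (\<lambda>k. u k + v k) (Suc m) \<le> rearr u (Suc n) + ennreal l'"
      if "0 \<le> l'" "finite (?S v l')" "card (?S v l') \<le> n" for l'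
      using that by (simp add: ennreal_minus_le_iff add.commute)
    then have "rearr (\<lambda>k. u k + v k) (Suc m) - rearr u (Suc n) \<le> rearr v (Suc n)"
      using False by (intro le_rearr) (simp add: ennreal_minus_le_iff)
    then show ?thesis using False by (simp add: ennreal_minus_le_iff)
  qed simp
qed

lemma abs_le_rearr_1:
  assumes "1 \<le> k"
  shows "ennreal \<bar>u k\<bar> \<le> rearr u (Suc 0)"
  using rearr_ge_if_card[of "{k}" 0 "\<bar>u k\<bar>" u] assms by auto

lemma rearr_le_bound:
  assumes "0 \<le> c" "\<And>k. 1 \<le> k \<Longrightarrow> \<bar>u k\<bar> \<le> c"
  shows "rearr u (Suc n) \<le> ennreal c"
proof -
  have "{k. 1 \<le> k \<and> \<bar>u k\<bar> > c} = {}" using assms(2) by (auto simp: not_less)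
  then show ?thesis using assms(1) by (intro rearr_le) (simp_all only: finite.emptyI card.empty le0)
qed

definition signed :: "(nat \<Rightarrow> real) \<Rightarrow> bool" where
  "signed v \<longleftrightarrow> v 0 = 0 \<and> (\<forall>k. v k = 0 \<or> \<bar>v k\<bar> = 1)"

definition support :: "(nat \<Rightarrow> real) \<Rightarrow> nat set" where
  "support v = {k. v k \<noteq> 0}"

lemma rearr_signed:
  assumes v: "signed v"
  shows "rearr v (Suc n) = (if finite (support v) \<and> card (support v) \<le> n then 0 else 1)"
proof (cases "finite (support v) \<and> card (support v) \<le> n")
  case True
  have "{k. 1 \<le> k \<and> \<bar>v k\<bar> > 0} = support v"
    using v by (auto simp: signed_def support_def Suc_le_eq intro: gr0I)
  then show ?thesis using True rearr_le[of 0 v n] by simp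
next
  case False
  then obtain E where E: "E \<subseteq> support v" "finite E" "card E = Suc n"
    by (metis infinite_arbitrarily_large not_less_eq_eq obtain_subset_with_card_n)
  have "ennreal 1 \<le> rearr v (Suc n)"
    using E v by (intro rearr_ge_if_card[of E]) (auto simp: signed_def support_def)
  moreover have "rearr v (Suc n) \<le> ennreal 1"
    using v by (intro rearr_le_bound) (auto simp: signed_def, metis abs_zero order_refl zero_le_one)
  ultimately show ?thesis using False by auto
qed

section \<open>The norm as a weighted sum of the rearrangement\<close>

lemma suminf_swap_ennreal: "(\<Sum>n. \<Sum>i. f n i) = (\<Sum>i. \<Sum>n. f n i :: ennreal)"
proof -
  have "(\<Sum>n. \<Sum>i. f n i) = (\<Sum>n. \<integral>\<^sup>+i. f n i \<partial>count_space UNIV)"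
    by (simp add: nn_integral_count_space_nat)
  also have "\<dots> = (\<integral>\<^sup>+i. (\<Sum>n. f n i) \<partial>count_space UNIV)"
    by (rule nn_integral_suminf[symmetric]) simp
  finally show ?thesis by (simp add: nn_integral_count_space_nat)
qed

locale weighted =
  fixes w :: "nat \<Rightarrow> real"
  assumes weight: "nonneg_weight w"
begin

definition tail :: "nat \<Rightarrow> real" where
  "tail j = (\<Sum>i. w (Suc (i + j)) / real (Suc (i + j)))"

text \<open>
  This is the fundamental sequence \<open>W(n) + W\<^sub>1(n)\<close>, written as a sum of its decreasing increments; the
  identification is \<open>fund_seq_eq\<close>.
\<close>

definition fund :: "nat \<Rightarrow> real" where
  "fund n = (\<Sum>j<n. tail j)"

lemma quotient_nonneg: "0 \<le> w (Suc i) / real (Suc i)"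
  using weight by (auto simp: nonneg_weight_def)

lemma summable_quotient: "summable (\<lambda>i. w (Suc i) / real (Suc i))"
proof -
  have "W1 w 1 < \<infinity>" using weight by (auto simp: nonneg_weight_def)
  then have "(\<Sum>i. ennreal (w (Suc (Suc i)) / real (Suc (Suc i)))) \<noteq> top"
    by (simp add: W1_def)
  then have "summable (\<lambda>i. w (Suc (Suc i)) / real (Suc (Suc i)))"
    using quotient_nonneg by (intro summable_suminf_not_top) blast+
  then show ?thesis using summable_Suc_iff[of "\<lambda>i. w (Suc i) / real (Suc i)"] by simp
qed

lemma summable_quotient_shift: "summable (\<lambda>i. w (Suc (i + j)) / real (Suc (i + j)))"
  using summable_quotient summable_iff_shift[of "\<lambda>i. w (Suc i) / real (Suc i)" j] by simp

lemma tail_nonneg: "0 \<le> tail j"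
  unfolding tail_def by (intro suminf_nonneg summable_quotient_shift quotient_nonneg)

lemma tail_Suc: "tail j = w (Suc j) / real (Suc j) + tail (Suc j)"
  using suminf_split_head[OF summable_quotient_shift[of j]] by (simp add: tail_def)

lemma tail_antimono: "i \<le> j \<Longrightarrow> tail j \<le> tail i"
proof (rule lift_Suc_antimono_le)
  show "tail (Suc n) \<le> tail n" for n
    using tail_Suc[of n] quotient_nonneg[of n] by linarith
qed

lemma tail_0_pos: "0 < tail 0"
proof -
  obtain n where "1 \<le> n" "0 < w n" using weight by (auto simp: nonneg_weight_def)
  then obtain i where "0 < w (Suc i)" by (cases n) auto
  then have "0 < w (Suc i) / real (Suc i)" by simp
  also have "\<dots> \<le> tail 0"
    using sum_le_suminf[OF summable_quotient, of "{i}"] quotient_nonneg by (simp add: tail_def)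
  finally show ?thesis .
qed

lemma tail_tendsto_0: "tail \<longlonglongrightarrow> 0"
proof -
  have "tail = (\<lambda>j. tail 0 - (\<Sum>i<j. w (Suc i) / real (Suc i)))"
    using suminf_minus_initial_segment[OF summable_quotient] by (auto simp: tail_def)
  moreover have "(\<lambda>j. tail 0 - (\<Sum>i<j. w (Suc i) / real (Suc i))) \<longlonglongrightarrow> tail 0 - tail 0"
    using summable_LIMSEQ[OF summable_quotient] by (intro tendsto_intros) (simp add: tail_def)
  ultimately show ?thesis by simp
qed

lemma fund_Suc: "fund (Suc n) = fund n + tail n"
  by (simp add: fund_def)

lemma fund_0 [simp]: "fund 0 = 0"
  by (simp add: fund_def)

lemma fund_nonneg: "0 \<le> fund n"
  unfolding fund_def by (intro sum_nonneg tail_nonneg)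

lemma fund_mono: "m \<le> n \<Longrightarrow> fund m \<le> fund n"
  unfolding fund_def by (intro sum_mono2) (auto simp: tail_nonneg)

lemma fund_pos: "1 \<le> n \<Longrightarrow> 0 < fund n"
  using fund_mono[of 1 n] tail_0_pos by (simp add: fund_def)

text \<open>
  The averages of a sequence that tends to 0 tend to 0.
\<close>

lemma fund_less_linear:
  assumes "e > 0"
  shows "\<exists>n\<ge>1. fund n < e * real n"
proof -
  have "eventually (\<lambda>j. tail j < e / 2) sequentially"
    using tail_tendsto_0 assms by (intro order_tendstoD) auto
  then obtain m where m: "tail m < e / 2" by (auto simp: eventually_sequentially)
  have le: "fund (m + i) \<le> fund m + real i * (e / 2)" for i
  proof (induction i)
    case (Suc i)
    then show ?case using tail_antimono[of m "m + i"] m by (simp add: fund_Suc field_simps)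
  qed simp
  obtain i :: nat where i: "fund m < real i * (e / 2)" "1 \<le> i"
  proof -
    obtain i :: nat where "fund m / (e / 2) < real i" using reals_Archimedean2 by blast
    then have "fund m < real i * (e / 2)" using assms by (simp add: field_simps)
    moreover from this have "1 \<le> i" using fund_nonneg[of m] by (cases i) auto
    ultimately show ?thesis using that by blast
  qed
  have "real i * e \<le> real (m + i) * e" using assms by (intro mult_right_mono) auto
  then have "fund (m + i) < e * real (m + i)" using le[of i] i by (simp add: algebra_simps)
  then show ?thesis using i(2) by (intro exI[of _ "m + i"]) auto
qed

text \<open>
  In \<open>\<Sum>n. (w n / n) (\<Sum>i\<le>n. u\<^sup>*(i))\<close> the value \<open>u\<^sup>*(i)\<close> is multiplied by \<open>\<Sum>n\<ge>i. w n / n\<close>.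
\<close>

lemma gamma_enorm_eq: "gamma_enorm w u = (\<Sum>n. rearr u (Suc n) * ennreal (tail n))"
proof -
  let ?a = "\<lambda>i. w (Suc i) / real (Suc i)"
  have "max_rearr u (Suc n) * ennreal (w (Suc n)) =
    (\<Sum>i. if i \<le> n then rearr u (Suc i) * ennreal (?a n) else 0)" for n
  proof -
    have "ennreal (?a n) = ennreal (w (Suc n)) / of_nat (Suc n)"
      using divide_ennreal[of "w (Suc n)" "real (Suc n)"] weight
      by (simp add: nonneg_weight_def ennreal_of_nat_eq_real_of_nat del: of_nat_Suc)
    moreover have "(\<Sum>i=1..Suc n. rearr u i) = (\<Sum>i<Suc n. rearr u (Suc i))"
      by (simp only: One_nat_def sum.atLeast1_atMost_eq)
    ultimately have "max_rearr u (Suc n) * ennreal (w (Suc n)) = (\<Sum>i<Suc n. rearr u (Suc i)) * ennreal (?a n)"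
      unfolding max_rearr_def by (simp only: divide_ennreal_def mult_ac)
    also have "\<dots> = (\<Sum>i<Suc n. if i \<le> n then rearr u (Suc i) * ennreal (?a n) else 0)"
      by (simp add: sum_distrib_right del: sum.lessThan_Suc)
    also have "\<dots> = (\<Sum>i. if i \<le> n then rearr u (Suc i) * ennreal (?a n) else 0)"
      by (rule suminf_finite[symmetric]) auto
    finally show ?thesis .
  qed
  then have "gamma_enorm w u = (\<Sum>n. \<Sum>i. if i \<le> n then rearr u (Suc i) * ennreal (?a n) else 0)"
    by (simp only: gamma_enorm_def)
  also have "\<dots> = (\<Sum>i. \<Sum>n. if i \<le> n then rearr u (Suc i) * ennreal (?a n) else 0)"
    by (rule suminf_swap_ennreal)
  also have "\<dots> = (\<Sum>i. rearr u (Suc i) * ennreal (tail i))"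
  proof (rule suminf_cong)
    fix i
    have "(\<Sum>n. if i \<le> n then rearr u (Suc i) * ennreal (?a n) else 0) =
      (\<Sum>n. rearr u (Suc i) * ennreal (?a (n + i)))"
      by (subst suminf_offset[of _ i]) auto
    also have "\<dots> = rearr u (Suc i) * ennreal (tail i)"
      unfolding tail_def using quotient_nonneg summable_quotient_shift[of i]
      by (simp add: suminf_ennreal2 del: of_nat_Suc)
    finally show "(\<Sum>n. if i \<le> n then rearr u (Suc i) * ennreal (?a n) else 0) = rearr u (Suc i) * ennreal (tail i)" .
  qed
  finally show ?thesis .
qed

lemma mem_gamma_iff: "u \<in> gamma w \<longleftrightarrow> u 0 = 0 \<and> gamma_enorm w u < \<infinity>"
  by (auto simp: gamma_def seqs_def)

lemma ennreal_gamma_norm: "u \<in> gamma w \<Longrightarrow> ennreal (gamma_norm w u) = gamma_enorm w u"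
  by (simp add: mem_gamma_iff gamma_norm_def)

lemma gamma_norm_nonneg: "0 \<le> gamma_norm w u"
  by (simp add: gamma_norm_def)

lemma gamma_boundI:
  assumes "0 \<le> c" "u 0 = 0" "gamma_enorm w u \<le> ennreal c"
  shows "u \<in> gamma w" "gamma_norm w u \<le> c"
  using assms by (auto simp: mem_gamma_iff gamma_norm_def enn2real_leI intro: le_less_trans)

lemma gamma_solid:
  assumes "v \<in> gamma w" "u 0 = 0" "\<And>k. 1 \<le> k \<Longrightarrow> \<bar>u k\<bar> \<le> \<bar>v k\<bar>"
  shows "u \<in> gamma w" "gamma_norm w u \<le> gamma_norm w v"
proof -
  have "gamma_enorm w u \<le> gamma_enorm w v"
    unfolding gamma_enorm_eq using assms(3) by (intro suminf_le mult_right_mono rearr_mono) auto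
  also have "\<dots> = ennreal (gamma_norm w v)" using assms(1) by (simp add: ennreal_gamma_norm)
  finally show "u \<in> gamma w" "gamma_norm w u \<le> gamma_norm w v"
    using assms(2) gamma_norm_nonneg by (auto intro: gamma_boundI)
qed

lemma gamma_enorm_scale: "gamma_enorm w (\<lambda>k. c * u k) = ennreal \<bar>c\<bar> * gamma_enorm w u"
  by (simp add: gamma_enorm_eq rearr_scale mult.assoc)

text \<open>
  The crude constant 2 is enough to make \<open>\<gamma>\<close> a vector space. The \<open>n\<close>-th term for the sum is bounded by the
  terms of index \<open>n div 2\<close> for \<open>u\<close> and \<open>v\<close>, and every index occurs twice.
\<close>

lemma gamma_enorm_add_le: "gamma_enorm w (\<lambda>k. u k + v k) \<le> 2 * (gamma_enorm w u + gamma_enorm w v)"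
proof -
  define g where "g n = (rearr u (Suc n) + rearr v (Suc n)) * ennreal (tail n)" for n
  define h where "h n = rearr (\<lambda>k. u k + v k) (Suc n) * ennreal (tail n)" for n
  have h: "h n \<le> g (n div 2)" for n
    unfolding g_def h_def by (intro mult_mono rearr_add_le ennreal_leI tail_antimono) auto
  have g: "(\<Sum>n. g n) = gamma_enorm w u + gamma_enorm w v"
    by (simp add: g_def gamma_enorm_eq suminf_add distrib_right)
  have "(\<Sum>n<N. h n) \<le> 2 * (\<Sum>n. g n)" for N
  proof -
    have "(\<Sum>n<N. h n) \<le> (\<Sum>n<2 * N. h n)" by (intro sum_mono2) auto
    also have "\<dots> \<le> 2 * (\<Sum>n<N. g n)"
    proof (induction N)
      case (Suc N)
      have "(\<Sum>n<2 * Suc N. h n) = (\<Sum>n<2 * N. h n) + (h (2 * N) + h (Suc (2 * N)))"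
        by (simp add: add.assoc)
      also have "\<dots> \<le> 2 * (\<Sum>n<N. g n) + (g N + g N)"
        using h[of "2 * N"] h[of "Suc (2 * N)"] by (intro add_mono Suc) auto
      finally show ?case by (simp add: distrib_left mult_2[symmetric])
    qed simp
    also have "\<dots> \<le> 2 * (\<Sum>n. g n)" by (intro mult_left_mono sum_le_suminf) auto
    finally show ?thesis .
  qed
  then have "(\<Sum>n. h n) \<le> 2 * (\<Sum>n. g n)" by (intro suminf_le_const) auto
  then show ?thesis by (simp only: g) (simp add: h_def gamma_enorm_eq)
qed

sublocale homogeneous_space "gamma w" "gamma_norm w"
proof
  show "(\<lambda>_. 0) \<in> gamma w"
    using gamma_enorm_scale[of 0 "\<lambda>_. 0"] by (simp add: mem_gamma_iff)
next
  fix u v a b assume uv: "u \<in> gamma w" "v \<in> gamma w"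
  have "gamma_enorm w (\<lambda>t. a * u t + b * v t) \<le>
    2 * (ennreal \<bar>a\<bar> * gamma_enorm w u + ennreal \<bar>b\<bar> * gamma_enorm w v)"
    using gamma_enorm_add_le[of "\<lambda>t. a * u t" "\<lambda>t. b * v t"] by (simp add: gamma_enorm_scale)
  also have "\<dots> < \<infinity>" using uv by (auto simp: mem_gamma_iff ennreal_mult_less_top)
  finally show "(\<lambda>t. a * u t + b * v t) \<in> gamma w" using uv by (simp add: mem_gamma_iff)
next
  show "gamma_norm w (\<lambda>t. c * u t) = \<bar>c\<bar> * gamma_norm w u" for u c
    by (simp add: gamma_norm_def gamma_enorm_scale enn2real_mult)
qed (rule gamma_norm_nonneg)

lemma rearr_tail_le: "rearr u (Suc n) * ennreal (tail n) \<le> gamma_enorm w u"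
  unfolding gamma_enorm_eq
  using sum_le_suminf[of "\<lambda>n. rearr u (Suc n) * ennreal (tail n)" "{n}"] by simp

lemma coordinate_bound:
  assumes "u \<in> gamma w"
  shows "\<bar>u k\<bar> \<le> gamma_norm w u / tail 0"
proof (cases "k = 0")
  case True
  then show ?thesis using assms tail_nonneg gamma_norm_nonneg by (simp add: mem_gamma_iff)
next
  case False
  have "ennreal (\<bar>u k\<bar> * tail 0) = ennreal \<bar>u k\<bar> * ennreal (tail 0)"
    using tail_nonneg by (simp add: ennreal_mult)
  also have "\<dots> \<le> rearr u (Suc 0) * ennreal (tail 0)"
    using False by (intro mult_right_mono abs_le_rearr_1) auto
  also have "\<dots> \<le> ennreal (gamma_norm w u)"
    unfolding ennreal_gamma_norm[OF assms] by (rule rearr_tail_le)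
  finally have "\<bar>u k\<bar> * tail 0 \<le> gamma_norm w u" using gamma_norm_nonneg by simp
  then show ?thesis using tail_0_pos by (simp add: field_simps)
qed

lemma signed_finite:
  assumes "signed v" "finite (support v)"
  shows "gamma_enorm w v = ennreal (fund (card (support v)))"
    and "v \<in> gamma w" and "gamma_norm w v = fund (card (support v))"
proof -
  have "gamma_enorm w v = (\<Sum>n<card (support v). rearr v (Suc n) * ennreal (tail n))"
    unfolding gamma_enorm_eq by (rule suminf_finite) (auto simp: rearr_signed assms)
  also have "\<dots> = ennreal (fund (card (support v)))"
    by (simp add: rearr_signed assms fund_def tail_nonneg sum_ennreal)
  finally show *: "gamma_enorm w v = ennreal (fund (card (support v)))" .
  then show "v \<in> gamma w" "gamma_norm w v = fund (card (support v))"
    using assms fund_nonneg by (auto simp: mem_gamma_iff signed_def gamma_norm_def)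
qed

lemma signed_infinite:
  assumes "signed v" "infinite (support v)" "v \<in> gamma w"
  shows "fund n \<le> gamma_norm w v"
proof -
  have "ennreal (fund n) = (\<Sum>i<n. rearr v (Suc i) * ennreal (tail i))"
    by (simp add: rearr_signed assms fund_def tail_nonneg sum_ennreal)
  also have "\<dots> \<le> ennreal (gamma_norm w v)"
    unfolding ennreal_gamma_norm[OF assms(3)] gamma_enorm_eq by (intro sum_le_suminf) auto
  finally show ?thesis using gamma_norm_nonneg by simp
qed

text \<open>
  A bound on \<open>fund\<close> amounts to \<open>W(\<infinity>) < \<infinity>\<close>; in that case \<open>\<gamma>\<close> contains sequences with infinitely many
  values of modulus 1.
\<close>

lemma bounded_sequence_in_gamma:
  assumes "0 \<le> C" "\<And>n. fund n \<le> C" "u 0 = 0" "\<And>k. \<bar>u k\<bar> \<le> 1"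
  shows "u \<in> gamma w" "gamma_norm w u \<le> C"
proof -
  have "(\<Sum>n<N. rearr u (Suc n) * ennreal (tail n)) \<le> ennreal C" for N
  proof -
    have "(\<Sum>n<N. rearr u (Suc n) * ennreal (tail n)) \<le> (\<Sum>n<N. ennreal 1 * ennreal (tail n))"
      using assms(4) by (intro sum_mono mult_right_mono rearr_le_bound) auto
    also have "\<dots> = ennreal (fund N)" by (simp add: fund_def tail_nonneg sum_ennreal)
    also have "\<dots> \<le> ennreal C" using assms(2) by (rule ennreal_leI)
    finally show ?thesis .
  qed
  then have "gamma_enorm w u \<le> ennreal C"
    unfolding gamma_enorm_eq by (intro suminf_le_const) auto
  then show "u \<in> gamma w" "gamma_norm w u \<le> C" using assms(1,3) by (auto intro: gamma_boundI)
qed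

lemma fund_seq_eq: "fund_seq w n = ennreal (fund n)"
proof -
  have "signed (indicator {1..n})" "support (indicator {1..n}) = {1..n}"
    by (auto simp: signed_def support_def indicator_def)
  then show ?thesis using signed_finite(1)[of "indicator {1..n}"] by (simp add: fund_seq_def)
qed

end

section \<open>Sign patterns determine the norm of a functional\<close>

definition layer :: "(nat \<Rightarrow> real) \<Rightarrow> real \<Rightarrow> nat \<Rightarrow> real" where
  "layer u c k = (if \<bar>u k\<bar> < c then 0 else sgn (u k))"

lemma signed_layer: "u 0 = 0 \<Longrightarrow> signed (layer u c)"
  by (auto simp: signed_def layer_def sgn_if)

text \<open>
  The sign pattern at height \<open>j * d\<close> contributes to the \<open>n\<close>-th entry only if more than \<open>n\<close> values of \<open>\<bar>u\<bar>\<close>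
  reach that height. There are at most \<open>u\<^sup>*(n + 1) / d\<close> such \<open>j\<close>.
\<close>

lemma sum_rearr_layer_le:
  assumes "0 < d" "u 0 = 0"
  shows "(\<Sum>j=1..J. ennreal d * rearr (layer u (real j * d)) (Suc n)) \<le> rearr u (Suc n)"
proof (rule le_rearr)
  fix l :: real
  assume l: "0 \<le> l" "finite {k. 1 \<le> k \<and> \<bar>u k\<bar> > l}" "card {k. 1 \<le> k \<and> \<bar>u k\<bar> > l} \<le> n"
  have "ennreal d * rearr (layer u (real j * d)) (Suc n) \<le> ennreal (if real j * d \<le> l then d else 0)" for j
  proof (cases "real j * d \<le> l")
    case True
    have "rearr (layer u (real j * d)) (Suc n) \<le> 1"
      using assms(2) by (simp add: rearr_signed signed_layer)
    then show ?thesis using True mult_left_mono[of _ 1 "ennreal d"] by simp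
  next
    case False
    have sub: "support (layer u (real j * d)) \<subseteq> {k. 1 \<le> k \<and> \<bar>u k\<bar> > l}"
      using False assms(2) by (auto simp: support_def layer_def Suc_le_eq intro: gr0I split: if_splits)
    then have "finite (support (layer u (real j * d)))" "card (support (layer u (real j * d))) \<le> n"
      using l finite_subset[OF sub] card_mono[OF l(2) sub] by auto
    then show ?thesis using False assms(2) by (simp add: rearr_signed signed_layer)
  qed
  then have "(\<Sum>j=1..J. ennreal d * rearr (layer u (real j * d)) (Suc n))
      \<le> (\<Sum>j=1..J. ennreal (if real j * d \<le> l then d else 0))"
    by (intro sum_mono)
  also have "\<dots> = ennreal (\<Sum>j=1..J. if real j * d \<le> l then d else 0)"
    using assms(1) by (intro sum_ennreal) auto
  also have "(\<Sum>j=1..J. if real j * d \<le> l then d else 0) \<le> (\<Sum>j=1..nat \<lfloor>l / d\<rfloor>. d)"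
  proof -
    have "(\<Sum>j=1..J. if real j * d \<le> l then d else 0) = (\<Sum>j\<in>{j\<in>{1..J}. real j * d \<le> l}. d)"
      by (rule sum.inter_filter[symmetric]) simp
    also have "\<dots> \<le> (\<Sum>j=1..nat \<lfloor>l / d\<rfloor>. d)"
      using assms(1) by (intro sum_mono2) (auto simp: le_nat_floor field_simps)
    finally show ?thesis .
  qed
  also have "\<dots> = real (nat \<lfloor>l / d\<rfloor>) * d" by simp
  also have "\<dots> \<le> l / d * d"
    using assms(1) l(1) by (intro mult_right_mono of_nat_floor) auto
  also have "\<dots> = l" using assms(1) by simp
  finally show "(\<Sum>j=1..J. ennreal d * rearr (layer u (real j * d)) (Suc n)) \<le> ennreal l"
    by (simp add: ennreal_leI)
qed

text \<open>
  The layers add up to \<open>u\<close> with the modulus rounded down to a multiple of \<open>d\<close>.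
\<close>

lemma layer_sum_approx:
  assumes "0 < d" "\<bar>u k\<bar> \<le> real J * d"
  defines "s \<equiv> (\<Sum>j=1..J. d * layer u (real j * d) k)"
  shows "\<bar>u k - s\<bar> \<le> d" "\<bar>u k - s\<bar> \<le> \<bar>u k\<bar>"
proof -
  define n where "n = nat \<lfloor>\<bar>u k\<bar> / d\<rfloor>"
  have n: "real n * d \<le> \<bar>u k\<bar>" "\<bar>u k\<bar> \<le> real n * d + d"
  proof -
    have "real n \<le> \<bar>u k\<bar> / d" "\<bar>u k\<bar> / d \<le> real n + 1"
      using assms(1) unfolding n_def by (intro of_nat_floor, simp) linarith
    then show "real n * d \<le> \<bar>u k\<bar>" "\<bar>u k\<bar> \<le> real n * d + d"
      using assms(1) by (simp_all add: field_simps)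
  qed
  have "real n * d \<le> real J * d" using n(1) assms(2) by linarith
  then have nJ: "n \<le> J" using assms(1) by simp
  have "s = (\<Sum>j=1..J. if real j * d \<le> \<bar>u k\<bar> then d * sgn (u k) else 0)"
    unfolding s_def by (intro sum.cong) (auto simp: layer_def)
  also have "\<dots> = (\<Sum>j\<in>{j\<in>{1..J}. real j * d \<le> \<bar>u k\<bar>}. d * sgn (u k))"
    by (rule sum.inter_filter[symmetric]) simp
  also have "{j\<in>{1..J}. real j * d \<le> \<bar>u k\<bar>} = {1..n}"
  proof -
    have "real j * d \<le> \<bar>u k\<bar> \<longleftrightarrow> j \<le> n" for j
    proof
      assume "j \<le> n"
      then have "real j * d \<le> real n * d" using assms(1) by simp
      then show "real j * d \<le> \<bar>u k\<bar>" using n(1) by linarith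
    next
      assume "real j * d \<le> \<bar>u k\<bar>"
      then have "real j \<le> \<bar>u k\<bar> / d" using assms(1) by (simp add: pos_le_divide_eq)
      then show "j \<le> n" unfolding n_def by (rule le_nat_floor)
    qed
    then show ?thesis using nJ by (auto simp only: mem_Collect_eq atLeastAtMost_iff intro: order_trans)
  qed
  finally have s: "s = real n * d * sgn (u k)" by simp
  have "u k = \<bar>u k\<bar> * sgn (u k)" by (simp add: sgn_if)
  then have "u k - s = (\<bar>u k\<bar> - real n * d) * sgn (u k)" unfolding s by (simp add: algebra_simps)
  then have "\<bar>u k - s\<bar> \<le> \<bar>\<bar>u k\<bar> - real n * d\<bar>"
    by (simp add: abs_mult sgn_if)
  moreover have "0 \<le> real n * d" using assms(1) by simp
  ultimately show "\<bar>u k - s\<bar> \<le> d" "\<bar>u k - s\<bar> \<le> \<bar>u k\<bar>" using n by linarith+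
qed

context weighted
begin

lemma layer_in_gamma:
  assumes u: "u \<in> gamma w" and c: "0 < c"
  shows "layer u c \<in> gamma w"
proof (rule gamma_solid(1))
  show "(\<lambda>t. inverse c * u t) \<in> gamma w" using u by (rule scale_mem)
  show "layer u c 0 = 0" using u c by (simp add: layer_def mem_gamma_iff)
  show "\<bar>layer u c k\<bar> \<le> \<bar>inverse c * u k\<bar>" for k
    using c by (auto simp: layer_def sgn_if abs_mult field_simps)
qed

lemma sum_layer_norm_le:
  assumes u: "u \<in> gamma w" and d: "0 < d"
  shows "(\<Sum>j=1..J. d * gamma_norm w (layer u (real j * d))) \<le> gamma_norm w u"
proof -
  let ?v = "\<lambda>j. layer u (real j * d)"
  have u0: "u 0 = 0" using u by (simp add: mem_gamma_iff)
  have "ennreal (\<Sum>j=1..J. d * gamma_norm w (?v j)) = (\<Sum>j=1..J. ennreal d * gamma_enorm w (?v j))"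
    using d u gamma_norm_nonneg
    by (subst sum_ennreal[symmetric]) (auto simp: ennreal_mult ennreal_gamma_norm layer_in_gamma intro!: sum.cong)
  also have "\<dots> = (\<Sum>n. \<Sum>j=1..J. ennreal d * (rearr (?v j) (Suc n) * ennreal (tail n)))"
    by (subst suminf_sum) (auto simp: gamma_enorm_eq)
  also have "\<dots> = (\<Sum>n. (\<Sum>j=1..J. ennreal d * rearr (?v j) (Suc n)) * ennreal (tail n))"
    by (simp add: sum_distrib_right mult.assoc)
  also have "\<dots> \<le> gamma_enorm w u"
    unfolding gamma_enorm_eq using u0 d
    by (intro suminf_le mult_right_mono sum_rearr_layer_le) auto
  also have "\<dots> = ennreal (gamma_norm w u)" using u by (simp add: ennreal_gamma_norm)
  finally show ?thesis using gamma_norm_nonneg by simp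
qed

text \<open>
  Dominated convergence: beyond some \<open>N\<close> the terms of the norm of \<open>u\<close> dominate, and the first \<open>N\<close> terms are
  controlled by the uniform bound \<open>d\<close>.
\<close>

lemma gamma_norm_small:
  assumes u: "u \<in> gamma w" and e: "0 < e"
  obtains d where "0 < d"
    "\<And>v. v 0 = 0 \<Longrightarrow> (\<And>k. \<bar>v k\<bar> \<le> d) \<Longrightarrow> (\<And>k. \<bar>v k\<bar> \<le> \<bar>u k\<bar>) \<Longrightarrow> gamma_norm w v \<le> e"
proof -
  define f where "f n = enn2real (rearr u (Suc n) * ennreal (tail n))" for n
  have fin: "gamma_enorm w u < \<infinity>" using u by (simp add: mem_gamma_iff)
  have f: "rearr u (Suc n) * ennreal (tail n) = ennreal (f n)" for n
    unfolding f_def using le_less_trans[OF rearr_tail_le fin] by simp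
  have f0: "0 \<le> f n" for n by (simp add: f_def)
  have sf: "summable f"
    using fin f0 by (intro summable_suminf_not_top) (auto simp: gamma_enorm_eq f)
  obtain N where N: "norm (\<Sum>i. f (i + N)) < e / 2"
    using suminf_exist_split[OF _ sf, of "e / 2"] e by auto
  define c where "c = fund N + 1"
  have c: "0 < c" using fund_nonneg[of N] by (simp add: c_def)
  define d where "d = e / (2 * c)"
  have d: "0 < d" using e c by (simp add: d_def)
  have "d * fund N \<le> d * c" using d by (simp add: c_def)
  also have "\<dots> = e / 2" using c by (simp add: d_def)
  finally have dN: "d * fund N \<le> e / 2" .
  have "gamma_norm w v \<le> e"
    if v: "v 0 = 0" "\<And>k. \<bar>v k\<bar> \<le> d" "\<And>k. \<bar>v k\<bar> \<le> \<bar>u k\<bar>" for v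
  proof -
    let ?g = "\<lambda>n. rearr v (Suc n) * ennreal (tail n)"
    have "(\<Sum>n. ?g (n + N)) \<le> (\<Sum>n. ennreal (f (n + N)))"
      unfolding f[symmetric] using v by (intro suminf_le mult_right_mono rearr_mono) auto
    also have "\<dots> = ennreal (\<Sum>n. f (n + N))"
      using f0 summable_iff_shift[of f N] sf by (intro suminf_ennreal2) auto
    also have "\<dots> \<le> ennreal (e / 2)" using N by (intro ennreal_leI) auto
    finally have 1: "(\<Sum>n. ?g (n + N)) \<le> ennreal (e / 2)" .
    have "(\<Sum>n<N. ?g n) \<le> (\<Sum>n<N. ennreal d * ennreal (tail n))"
      using v d by (intro sum_mono mult_right_mono rearr_le_bound) auto
    also have "\<dots> = ennreal (d * fund N)"
      using d by (simp add: fund_def tail_nonneg sum_ennreal ennreal_mult[symmetric] sum_distrib_left)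
    also have "\<dots> \<le> ennreal (e / 2)" using dN by (rule ennreal_leI)
    finally have 2: "(\<Sum>n<N. ?g n) \<le> ennreal (e / 2)" .
    have "gamma_enorm w v = (\<Sum>n. ?g (n + N)) + (\<Sum>n<N. ?g n)"
      unfolding gamma_enorm_eq by (rule suminf_offset) simp
    also have "\<dots> \<le> ennreal (e / 2) + ennreal (e / 2)" using 1 2 by (rule add_mono)
    also have "\<dots> = ennreal e" using e by (simp add: ennreal_plus[symmetric] del: ennreal_plus)
    finally show ?thesis using v(1) e by (intro gamma_boundI) auto
  qed
  then show ?thesis using d that by blast
qed

text \<open>
  Round \<open>u\<close> down to a sum of layers. The error has small norm, and on the layers the hypothesis applies with
  norms that sum to at most the norm of \<open>u\<close>. The argument covers sign patterns of infinite support and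
  functionals without a representing sequence.
\<close>

lemma functional_le_if_le_on_signed:
  assumes M: "M \<in> gamma_dual w" and K: "0 \<le> K"
    and le: "\<And>v. v \<in> gamma w \<Longrightarrow> signed v \<Longrightarrow> M v \<le> K * gamma_norm w v"
    and u: "u \<in> gamma w"
  shows "M u \<le> K * gamma_norm w u"
proof (rule field_le_epsilon)
  fix e :: real assume e: "0 < e"
  define D where "D = gamma_dual_norm w M"
  have D: "0 \<le> D" unfolding D_def by (rule dual_norm_nonneg[OF M])
  have "0 < e / (D + 1)" using e D by simp
  then obtain d where d: "0 < d"
    "\<And>v. v 0 = 0 \<Longrightarrow> (\<And>k. \<bar>v k\<bar> \<le> d) \<Longrightarrow> (\<And>k. \<bar>v k\<bar> \<le> \<bar>u k\<bar>) \<Longrightarrow> gamma_norm w v \<le> e / (D + 1)"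
    using gamma_norm_small[OF u] by blast
  obtain J :: nat where "gamma_norm w u / tail 0 / d < real J" using reals_Archimedean2 by blast
  then have "gamma_norm w u / tail 0 \<le> real J * d"
    by (subst (asm) pos_divide_less_eq[OF d(1)]) (rule less_imp_le)
  then have J: "\<bar>u k\<bar> \<le> real J * d" for k using coordinate_bound[OF u, of k] by linarith
  let ?v = "\<lambda>j t. d * layer u (real j * d) t"
  define s where "s = (\<lambda>t. \<Sum>j\<in>{1..J}. ?v j t)"
  have lay: "layer u (real j * d) \<in> gamma w" "signed (layer u (real j * d))" if "j \<in> {1..J}" for j
    using that d(1) layer_in_gamma[OF u] u by (auto intro!: signed_layer simp: mem_gamma_iff[of u])
  then have "?v j \<in> gamma w" if "j \<in> {1..J}" for j using that by (intro scale_mem)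
  note s_sum = dual_sum[OF M, of "{1..J}" ?v, OF _ this, folded s_def]
  then have s: "s \<in> gamma w" "M s = (\<Sum>j=1..J. M (?v j))" by auto
  have "M s = (\<Sum>j=1..J. d * M (layer u (real j * d)))"
    unfolding s(2) using lay by (intro sum.cong refl dual_scale[OF M]) auto
  also have "\<dots> \<le> (\<Sum>j=1..J. d * (K * gamma_norm w (layer u (real j * d))))"
    using d(1) lay by (intro sum_mono mult_left_mono le) auto
  also have "\<dots> = K * (\<Sum>j=1..J. d * gamma_norm w (layer u (real j * d)))"
    by (simp add: sum_distrib_left mult_ac)
  also have "\<dots> \<le> K * gamma_norm w u"
    by (intro mult_left_mono sum_layer_norm_le u d K)
  finally have Ms: "M s \<le> K * gamma_norm w u" .
  let ?r = "\<lambda>t. 1 * u t + (- 1) * s t"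
  have r: "?r \<in> gamma w" using u s(1) by (rule comb_mem)
  have "gamma_norm w ?r \<le> e / (D + 1)"
  proof (rule d(2))
    show "?r 0 = 0" using r by (simp add: mem_gamma_iff)
  qed (use layer_sum_approx[of d u] J d(1) in \<open>auto simp: s_def\<close>)
  then have "D * gamma_norm w ?r \<le> D * (e / (D + 1))" using D by (rule mult_left_mono)
  also have "\<dots> \<le> e" using D e by (simp add: field_simps)
  finally have "\<bar>M ?r\<bar> \<le> e" using abs_le_dual_norm[OF M r] unfolding D_def by linarith
  moreover have "M ?r = M u - M s" using dual_comb[OF M u s(1), of 1 "- 1"] by simp
  ultimately show "M u \<le> K * gamma_norm w u + e" using Ms by linarith
qed

lemma dual_norm_le_if_le_on_signed:
  assumes M: "M \<in> gamma_dual w" and K: "0 \<le> K"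
    and le: "\<And>v. v \<in> gamma w \<Longrightarrow> signed v \<Longrightarrow> M v \<le> K * gamma_norm w v"
  shows "gamma_dual_norm w M \<le> K"
proof (rule dual_norm_leI[OF K])
  fix u assume u: "u \<in> gamma w"
  have u': "(\<lambda>t. - 1 * u t) \<in> gamma w" using u by (rule scale_mem)
  have "- M u \<le> K * gamma_norm w u"
    using functional_le_if_le_on_signed[OF M K le u'] dual_scale[OF M u, of "- 1"] N_scale[OF u, of "- 1"]
    by simp
  then show "\<bar>M u\<bar> \<le> K * gamma_norm w u"
    using functional_le_if_le_on_signed[OF M K le u] by linarith
qed

end

section \<open>Functionals represented by a sequence\<close>

lemma (in homogeneous_space) restricted_functional_in_dual:
  assumes "\<And>u v a b. u \<in> V \<Longrightarrow> v \<in> V \<Longrightarrow> h (\<lambda>t. a * u t + b * v t) = a * h u + b * h v"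
    and "\<And>u. u \<in> V \<Longrightarrow> \<bar>h u\<bar> \<le> C * N u"
  shows "(\<lambda>u. if u \<in> V then h u else 0) \<in> dual V N"
  unfolding dual_def using assms comb_mem by (auto intro!: exI[of _ C])

text \<open>
  The value at 0 has to be nonzero: the sign patterns below must have full support even where \<open>x\<close> vanishes.
\<close>

definition unit_sign :: "real \<Rightarrow> real" where
  "unit_sign t = (if 0 \<le> t then 1 else - 1)"

lemma unit_sign_mult_self: "unit_sign t * t = \<bar>t\<bar>" and abs_unit_sign: "\<bar>unit_sign t\<bar> = 1"
  by (auto simp: unit_sign_def)

locale dual_sequence = weighted +
  fixes F :: "(nat \<Rightarrow> real) \<Rightarrow> real" and x :: "nat \<Rightarrow> real"
  assumes F: "F \<in> unit_sphere (gamma_dual w) (gamma_dual_norm w)"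
    and x: "given_by (gamma w) F x"
begin

lemma F_dual: "F \<in> gamma_dual w" and F_norm: "gamma_dual_norm w F = 1"
  using F by (auto simp: unit_sphere_def)

lemma F_le: "u \<in> gamma w \<Longrightarrow> \<bar>F u\<bar> \<le> gamma_norm w u"
  using abs_le_dual_norm[OF F_dual] F_norm by simp

lemma x_0: "x 0 = 0"
  using x by (simp add: given_by_def seqs_def)

lemma pairing:
  assumes "u \<in> gamma w"
  shows "(\<lambda>k. u k * x k) sums F u"
  using assms x x_0 sums_Suc_iff[of "\<lambda>k. u k * x k" "F u"] by (simp add: given_by_def)

lemma pairing_finite:
  assumes "u \<in> gamma w" "finite E" "\<And>k. k \<notin> E \<Longrightarrow> u k = 0"
  shows "F u = (\<Sum>k\<in>E. u k * x k)"
  using sums_unique2[OF pairing[OF assms(1)] sums_finite[OF assms(2)]] assms(3) by simp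

definition sign_on :: "nat set \<Rightarrow> nat \<Rightarrow> real" where
  "sign_on A k = (if k \<in> A then unit_sign (x k) else 0)"

lemma sign_on:
  assumes "0 \<notin> A"
  shows "signed (sign_on A)" "support (sign_on A) = A"
  using assms by (auto simp: signed_def support_def sign_on_def unit_sign_def)

lemma sign_on_finite:
  assumes "finite A" "0 \<notin> A"
  shows "sign_on A \<in> gamma w" "gamma_norm w (sign_on A) = fund (card A)"
    and "F (sign_on A) = (\<Sum>k\<in>A. \<bar>x k\<bar>)"
proof -
  show *: "sign_on A \<in> gamma w" and "gamma_norm w (sign_on A) = fund (card A)"
    using signed_finite[of "sign_on A"] sign_on[OF assms(2)] assms(1) by auto
  show "F (sign_on A) = (\<Sum>k\<in>A. \<bar>x k\<bar>)"
    by (subst pairing_finite[OF * assms(1)]) (auto simp: sign_on_def unit_sign_mult_self)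
qed

lemma sum_abs_le_fund:
  assumes "finite A" "0 \<notin> A"
  shows "(\<Sum>k\<in>A. \<bar>x k\<bar>) \<le> fund (card A)"
  using F_le[OF sign_on_finite(1)[OF assms]] sign_on_finite(2,3)[OF assms] by simp

text \<open>
  \<open>n\<close> values of modulus at least \<open>e\<close> would give \<open>e * n \<le> fund n\<close>, but \<open>fund\<close> grows sublinearly. So \<open>x\<close> tends
  to 0 and can be enumerated by decreasing modulus.
\<close>

lemma finitely_many_large:
  assumes "0 < e"
  shows "finite {k. e \<le> \<bar>x k\<bar>}"
proof (rule ccontr)
  assume inf: "infinite {k. e \<le> \<bar>x k\<bar>}"
  obtain n where n: "fund n < e * real n" using fund_less_linear[OF assms] by blast
  obtain A where A: "A \<subseteq> {k. e \<le> \<bar>x k\<bar>}" "finite A" "card A = n"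
    using infinite_arbitrarily_large[OF inf] by blast
  have "e * real n = (\<Sum>k\<in>A. e)" using A by simp
  also have "\<dots> \<le> (\<Sum>k\<in>A. \<bar>x k\<bar>)" using A by (intro sum_mono) auto
  also have "\<dots> \<le> fund n"
  proof -
    have "0 \<notin> A" using A(1) x_0 assms by auto
    then show ?thesis using sum_abs_le_fund[of A] A by simp
  qed
  finally show False using n by simp
qed

lemma max_outside_finite_set:
  assumes "finite A"
  shows "\<exists>k. 1 \<le> k \<and> k \<notin> A \<and> (\<forall>j\<ge>1. j \<notin> A \<longrightarrow> \<bar>x j\<bar> \<le> \<bar>x k\<bar>)"
proof (cases "\<exists>j\<ge>1. j \<notin> A \<and> x j \<noteq> 0")
  case True
  then obtain i where i: "1 \<le> i" "i \<notin> A" "x i \<noteq> 0" by blast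
  let ?B = "{k. \<bar>x i\<bar> \<le> \<bar>x k\<bar>} \<inter> {k. 1 \<le> k \<and> k \<notin> A}"
  have "finite ?B" using finitely_many_large[of "\<bar>x i\<bar>"] i by auto
  moreover have "i \<in> ?B" using i by auto
  ultimately have fin: "finite ((\<lambda>k. \<bar>x k\<bar>) ` ?B)" and ne: "(\<lambda>k. \<bar>x k\<bar>) ` ?B \<noteq> {}" by blast+
  obtain k where kB: "k \<in> ?B" and max: "Max ((\<lambda>k. \<bar>x k\<bar>) ` ?B) = \<bar>x k\<bar>"
    using Max_in[OF fin ne] by (rule imageE)
  have k: "\<bar>x j\<bar> \<le> \<bar>x k\<bar>" if "j \<in> ?B" for j
    using Max_ge[OF fin imageI[OF that]] unfolding max .
  have "\<bar>x j\<bar> \<le> \<bar>x k\<bar>" if "1 \<le> j" "j \<notin> A" for j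
    using kB k that by (cases "\<bar>x i\<bar> \<le> \<bar>x j\<bar>") auto
  then show ?thesis using kB by auto
next
  case False
  obtain k where "k \<notin> insert 0 A" using assms ex_new_if_finite[of "insert 0 A"] by auto
  then show ?thesis using False by (intro exI[of _ k]) auto
qed

definition decreasing_enumeration :: "(nat \<Rightarrow> nat) \<Rightarrow> bool" where
  "decreasing_enumeration a \<longleftrightarrow>
     inj a \<and> (\<forall>i. 1 \<le> a i) \<and> (\<forall>i. \<forall>k\<ge>1. k \<notin> a ` {..<i} \<longrightarrow> \<bar>x k\<bar> \<le> \<bar>x (a i)\<bar>)"

lemma decreasing_enumeration_exists: "\<exists>a. decreasing_enumeration a"
proof -
  have "\<forall>A. \<exists>k. finite A \<longrightarrow> 1 \<le> k \<and> k \<notin> A \<and> (\<forall>j\<ge>1. j \<notin> A \<longrightarrow> \<bar>x j\<bar> \<le> \<bar>x k\<bar>)"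
    using max_outside_finite_set by blast
  then obtain pick where pick:
    "\<And>A. finite A \<Longrightarrow> 1 \<le> pick A \<and> pick A \<notin> A \<and> (\<forall>j\<ge>1. j \<notin> A \<longrightarrow> \<bar>x j\<bar> \<le> \<bar>x (pick A)\<bar>)"
    by metis
  define B where "B = rec_nat {} (\<lambda>_ B. insert (pick B) B)"
  define a where "a n = pick (B n)" for n
  have B: "B n = a ` {..<n}" for n
    by (induction n) (auto simp: B_def a_def lessThan_Suc)
  have fin: "finite (B n)" for n unfolding B by simp
  have "a i \<noteq> a j" if "i < j" for i j
  proof -
    have "a i \<in> B j" using that unfolding B by simp
    moreover have "a j \<notin> B j" using pick[OF fin[of j]] unfolding a_def by blast
    ultimately show ?thesis by metis
  qed
  then have "inj a" by (intro injI) (metis nat_neq_iff)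
  moreover have "1 \<le> a i" "\<forall>k\<ge>1. k \<notin> a ` {..<i} \<longrightarrow> \<bar>x k\<bar> \<le> \<bar>x (a i)\<bar>" for i
    using pick[OF fin[of i]] unfolding B[symmetric] a_def[of i] by blast+
  ultimately have "decreasing_enumeration a" unfolding decreasing_enumeration_def by blast
  then show ?thesis by blast
qed

definition enum :: "nat \<Rightarrow> nat" where
  "enum = (SOME a. decreasing_enumeration a)"

definition S :: "nat \<Rightarrow> real" where
  "S n = (\<Sum>i<n. \<bar>x (enum i)\<bar>)"

lemma enum: "decreasing_enumeration enum"
  unfolding enum_def using decreasing_enumeration_exists by (rule someI_ex)

lemma inj_enum: "inj enum" and enum_ge_1: "1 \<le> enum i"
  using enum by (auto simp: decreasing_enumeration_def)

lemma abs_le_enum: "k \<notin> enum ` {..<i} \<Longrightarrow> \<bar>x k\<bar> \<le> \<bar>x (enum i)\<bar>"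
  using enum x_0 by (cases "k = 0") (auto simp: decreasing_enumeration_def Suc_le_eq)

lemma enum_antimono: "i \<le> j \<Longrightarrow> \<bar>x (enum j)\<bar> \<le> \<bar>x (enum i)\<bar>"
  by (intro abs_le_enum) (auto simp: inj_eq[OF inj_enum])

text \<open>
  \<open>\<bar>x\<bar>\<close> exceeds \<open>l\<close> at most \<open>n\<close> times exactly if its \<open>n\<close>-th enumerated value, counted from 0, is at most \<open>l\<close>.
\<close>

lemma rearr_eq: "rearr x (Suc n) = ennreal \<bar>x (enum n)\<bar>"
proof (rule antisym)
  let ?A = "{k. 1 \<le> k \<and> \<bar>x k\<bar> > \<bar>x (enum n)\<bar>}"
  have sub: "?A \<subseteq> enum ` {..<n}" using abs_le_enum[of _ n] by force
  then have "card ?A \<le> n"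
    using card_mono[OF _ sub] card_image_le[of "{..<n}" enum] by simp
  then show "rearr x (Suc n) \<le> ennreal \<bar>x (enum n)\<bar>"
    using sub by (intro rearr_le) (auto intro: finite_subset)
  show "ennreal \<bar>x (enum n)\<bar> \<le> rearr x (Suc n)"
  proof (rule rearr_ge_if_card)
    show "Suc n \<le> card (enum ` {..n})" using inj_enum by (simp add: card_image inj_on_subset)
    show "0 \<notin> enum ` {..n}"
    proof
      assume "0 \<in> enum ` {..n}"
      then obtain i where "enum i = 0" by auto
      then show False using enum_ge_1[of i] by simp
    qed
  qed (auto intro: enum_antimono)
qed

definition top_set :: "nat \<Rightarrow> nat set" where
  "top_set n = enum ` {..<n}"

lemma top_set: "finite (top_set n)" "card (top_set n) = n" "0 \<notin> top_set n"
proof -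
  show "finite (top_set n)" "card (top_set n) = n"
    using inj_enum by (auto simp: top_set_def card_image inj_on_subset)
  show "0 \<notin> top_set n"
  proof
    assume "0 \<in> top_set n"
    then obtain i where "enum i = 0" by (auto simp: top_set_def)
    then show False using enum_ge_1[of i] by simp
  qed
qed

lemma sum_top_set: "(\<Sum>k\<in>top_set n. f k) = (\<Sum>i<n. f (enum i))"
  unfolding top_set_def using inj_enum by (simp add: sum.reindex inj_on_subset)

lemma S_Suc: "S (Suc n) = S n + \<bar>x (enum n)\<bar>" and S_0: "S 0 = 0"
  by (simp_all add: S_def)

lemma S_nonneg: "0 \<le> S n"
  by (simp add: S_def sum_nonneg)

lemma sign_top:
  shows "sign_on (top_set n) \<in> gamma w" "gamma_norm w (sign_on (top_set n)) = fund n"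
    and "F (sign_on (top_set n)) = S n"
  using sign_on_finite[OF top_set(1,3)] top_set(2) by (simp_all add: sum_top_set S_def)

lemma S_le_fund: "S n \<le> fund n"
  using F_le[OF sign_top(1)[of n]] by (simp add: sign_top)

lemma max_rearr_psi:
  assumes "1 \<le> n"
  shows "max_rearr x n * psi w n = ennreal (S n / fund n)"
proof -
  have "(\<Sum>i=1..n. rearr x i) = (\<Sum>i<n. rearr x (Suc i))"
    by (simp only: One_nat_def sum.atLeast1_atMost_eq)
  also have "\<dots> = ennreal (S n)" by (simp add: rearr_eq S_def)
  finally have "max_rearr x n = ennreal (S n / real n)"
    using assms S_nonneg by (simp add: max_rearr_def ennreal_of_nat_eq_real_of_nat divide_ennreal)
  moreover have "psi w n = ennreal (real n / fund n)"
    using fund_pos[OF assms] by (simp add: psi_def fund_seq_eq ennreal_of_nat_eq_real_of_nat divide_ennreal)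
  ultimately show ?thesis
    using assms S_nonneg fund_nonneg by (simp add: ennreal_mult[symmetric])
qed

text \<open>
  Elements of \<open>E\<close> are removed one at a time. By counting, the remaining set always contains an element outside
  the corresponding top set, whose modulus is at most the next enumerated value.
\<close>

lemma sum_abs_le_S:
  assumes "finite E" "b \<in> E"
  shows "(\<Sum>k\<in>E. \<bar>x k\<bar>) \<le> S (card E - 1) + \<bar>x b\<bar>"
  using assms
proof (induction "card E" arbitrary: E b)
  case (Suc n)
  have cE: "card (E - {b}) = n" using Suc.prems Suc.hyps(2) by (simp add: card_Diff_singleton)
  have "(\<Sum>k\<in>E - {b}. \<bar>x k\<bar>) \<le> S n"
  proof (cases n)
    case 0
    then have "card (E - {b}) = 0" "finite (E - {b})" using cE Suc.prems by auto
    then have "E - {b} = {}" by (simp only: card_0_eq)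
    then show ?thesis using S_nonneg by (simp only: sum.empty)
  next
    case (Suc m)
    \<comment> \<open>The next element to remove must lie outside the top set of size one less.\<close>
    have "\<not> E - {b} \<subseteq> top_set m"
    proof
      assume "E - {b} \<subseteq> top_set m"
      from card_mono[OF top_set(1) this] show False using cE Suc by (simp add: top_set)
    qed
    then obtain c where c: "c \<in> E - {b}" "c \<notin> top_set m" by blast
    have "(\<Sum>k\<in>E - {b}. \<bar>x k\<bar>) \<le> S (card (E - {b}) - 1) + \<bar>x c\<bar>"
      using c cE Suc.prems by (intro Suc.hyps(1)) auto
    also have "\<dots> \<le> S n" using abs_le_enum[of c m] c cE Suc by (simp add: S_Suc top_set_def)
    finally show ?thesis .
  qed
  then show ?case using Suc.prems by (simp add: sum.remove[of E b] Suc.hyps(2)[symmetric])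
qed simp

end

context dual_sequence
begin

section \<open>A strict maximum gives smoothness\<close>

lemma support_finite_pairing:
  assumes "signed v" "finite (support v)" "v \<in> gamma w"
  shows "F v = (\<Sum>k\<in>support v. v k * x k)"
  using assms by (intro pairing_finite) (auto simp: support_def)

lemma signed_mult_le: "signed v \<Longrightarrow> v k * x k \<le> \<bar>x k\<bar>"
  using abs_ge_self[of "v k * x k"] by (auto simp: signed_def abs_mult) (metis abs_ge_zero mult_1 mult_zero_left)

lemma F_signed_le_S:
  assumes v: "signed v" "finite (support v)" "v \<in> gamma w"
  shows "F v \<le> S (card (support v))"
proof (cases "support v = {}")
  case True
  then show ?thesis using v by (simp add: support_finite_pairing S_0)
next
  case False
  then have pos: "0 < card (support v)" using v by (simp add: card_gt_0_iff)
  have "\<not> support v \<subseteq> top_set (card (support v) - 1)"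
  proof
    assume "support v \<subseteq> top_set (card (support v) - 1)"
    from card_mono[OF top_set(1) this] show False using pos by (simp add: top_set)
  qed
  then obtain b where b: "b \<in> support v" "b \<notin> top_set (card (support v) - 1)" by blast
  have "F v \<le> (\<Sum>k\<in>support v. \<bar>x k\<bar>)"
    unfolding support_finite_pairing[OF v] using v by (intro sum_mono signed_mult_le)
  also have "\<dots> \<le> S (card (support v) - 1) + \<bar>x b\<bar>" by (rule sum_abs_le_S[OF v(2) b(1)])
  also have "\<dots> \<le> S (Suc (card (support v) - 1))"
    using abs_le_enum[of b] b(2) by (simp add: S_Suc top_set_def)
  finally show ?thesis using pos by simp
qed

text \<open>
  Truncations of \<open>v\<close> are finite sign patterns; those of size above \<open>N\<close> satisfy the bound, and \<open>F v\<close> is the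
  limit of the values at truncations because the pairing converges.
\<close>

lemma F_infinite_signed_le:
  assumes v: "signed v" "infinite (support v)" "v \<in> gamma w"
    and q: "0 \<le> q" "\<And>n. N < n \<Longrightarrow> S n \<le> q * fund n"
  shows "F v \<le> q * gamma_norm w v"
proof (rule LIMSEQ_le_const2)
  show "(\<lambda>m. \<Sum>k<m. v k * x k) \<longlonglongrightarrow> F v"
    using pairing[OF v(3)] by (simp add: sums_def)
  obtain A where A: "A \<subseteq> support v" "finite A" "card A = Suc N"
    using infinite_arbitrarily_large[OF v(2)] by blast
  have "(\<Sum>k<m. v k * x k) \<le> q * gamma_norm w v" if m: "Suc (Max A) \<le> m" for m
  proof -
    let ?v = "\<lambda>k. if k < m then v k else 0"
    have sv: "signed ?v" using v(1) by (auto simp: signed_def)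
    have fin: "finite (support ?v)"
      by (rule finite_subset[of _ "{..<m}"]) (auto simp: support_def split: if_splits)
    have vg: "?v \<in> gamma w" by (rule signed_finite(2)[OF sv fin])
    have "k \<in> support ?v" if "k \<in> A" for k
    proof -
      have "k < m" using m Max_ge[OF A(2) that] by linarith
      then show ?thesis using that A(1) by (auto simp: support_def)
    qed
    then have "A \<subseteq> support ?v" by blast
    from card_mono[OF fin this] have card: "N < card (support ?v)" using A(3) by simp
    have "(\<Sum>k<m. v k * x k) = F ?v"
      using pairing_finite[OF vg, of "{..<m}"] by simp
    also have "\<dots> \<le> S (card (support ?v))" by (rule F_signed_le_S[OF sv fin vg])
    also have "\<dots> \<le> q * fund (card (support ?v))" using card by (rule q(2))
    also have "\<dots> \<le> q * gamma_norm w v" using q(1) v by (intro mult_left_mono signed_infinite)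
    finally show ?thesis .
  qed
  then show "\<exists>N. \<forall>m\<ge>N. (\<Sum>k<m. v k * x k) \<le> q * gamma_norm w v" by blast
qed

text \<open>
  Any bound for the ratios \<open>S n / fund n\<close> bounds \<open>F\<close> on sign patterns, hence the norm of \<open>F\<close>, which is 1.
\<close>

lemma sup_ratio_ge_1:
  assumes q: "0 \<le> q" "\<And>n. 1 \<le> n \<Longrightarrow> S n \<le> q * fund n"
  shows "1 \<le> q"
proof -
  have all: "S n \<le> q * fund n" for n using q(2)[of n] by (cases n) (auto simp: S_0)
  have "gamma_dual_norm w F \<le> q"
  proof (rule dual_norm_le_if_le_on_signed[OF F_dual q(1)])
    fix v assume v: "v \<in> gamma w" "signed v"
    show "F v \<le> q * gamma_norm w v"
    proof (cases "finite (support v)")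
      case True
      have "F v \<le> S (card (support v))" using v True by (intro F_signed_le_S)
      also have "\<dots> \<le> q * gamma_norm w v" using all v True by (simp add: signed_finite)
      finally show ?thesis .
    next
      case False
      then show ?thesis using F_infinite_signed_le[OF v(2) False v(1) q(1)] all by blast
    qed
  qed
  then show ?thesis using F_norm by simp
qed

text \<open>
  The increments of \<open>S\<close> are the enumerated values and those of \<open>fund\<close> are the values of \<open>tail\<close>. As \<open>S\<close> touches
  \<open>fund\<close> from below at \<open>n\<close> and is strictly below at the next point, the increment of \<open>S\<close> before \<open>n\<close> is at least
  that of \<open>fund\<close>, the one after \<open>n\<close> is smaller than that of \<open>fund\<close>, and \<open>tail\<close> decreases.
\<close>

lemma drop_at_strict_maximum:
  assumes n: "1 \<le> n" "S n = fund n" and q: "q < 1" "S (Suc n) \<le> q * fund (Suc n)"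
  shows "\<bar>x (enum n)\<bar> < \<bar>x (enum (n - 1))\<bar>"
proof -
  obtain m where m: "n = Suc m" using n(1) by (cases n) auto
  have "S (Suc n) < fund (Suc n)" using q fund_pos[of "Suc n"]
    by (smt (verit) le_add1 mult_less_cancel_right2 plus_1_eq_Suc)
  then have "\<bar>x (enum n)\<bar> < tail n" using n(2) by (simp add: S_Suc fund_Suc)
  also have "\<dots> \<le> tail m" using m by (intro tail_antimono) simp
  also have "\<dots> \<le> \<bar>x (enum m)\<bar>" using n(2) S_le_fund[of m] unfolding m S_Suc fund_Suc by linarith
  finally show ?thesis using m by simp
qed

text \<open>
  A competitor of the same size either trades an element of the top set for one of modulus at most that of
  \<open>x (enum n)\<close>, or carries a wrong sign at an element of the top set and loses twice its modulus.
\<close>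

lemma F_signed_gap:
  assumes n: "1 \<le> n" and v: "signed v" "finite (support v)" "card (support v) = n" "v \<in> gamma w"
    and ne: "v \<noteq> sign_on (top_set n)"
    and drop: "\<bar>x (enum n)\<bar> < \<bar>x (enum (n - 1))\<bar>"
  shows "F v \<le> S n - (\<bar>x (enum (n - 1))\<bar> - \<bar>x (enum n)\<bar>)"
proof (cases "support v \<subseteq> top_set n")
  case False
  obtain m where m: "n = Suc m" using n by (cases n) auto
  obtain b where b: "b \<in> support v" "b \<notin> top_set n" using False by blast
  have "F v \<le> (\<Sum>k\<in>support v. \<bar>x k\<bar>)"
    unfolding support_finite_pairing[OF v(1,2,4)] using v by (intro sum_mono signed_mult_le)
  also have "\<dots> \<le> S m + \<bar>x b\<bar>" using sum_abs_le_S[OF v(2) b(1)] v(3) m by simp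
  also have "\<bar>x b\<bar> \<le> \<bar>x (enum n)\<bar>" using b(2) by (intro abs_le_enum) (simp add: top_set_def)
  finally show ?thesis by (simp add: m S_Suc)
next
  case True
  then have supp: "support v = top_set n" using v(3) by (intro card_subset_eq top_set) (simp_all add: top_set)
  obtain k where k: "v k \<noteq> sign_on (top_set n) k" using ne by blast
  then have kA: "k \<in> top_set n" using supp by (auto simp: support_def sign_on_def split: if_splits)
  then obtain i where i: "i < n" "k = enum i" by (auto simp: top_set_def)
  have large: "\<bar>x (enum (n - 1))\<bar> \<le> \<bar>x k\<bar>" unfolding i(2) using i(1) by (intro enum_antimono) simp
  have "\<bar>v k\<bar> = 1" using v(1) kA supp by (auto simp: signed_def support_def)
  then have vk: "v k = - unit_sign (x k)" using k kA by (auto simp: sign_on_def unit_sign_def split: if_splits)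
  have "F v = v k * x k + (\<Sum>j\<in>top_set n - {k}. v j * x j)"
    unfolding support_finite_pairing[OF v(1,2,4)] supp by (rule sum.remove[OF top_set(1) kA])
  also have "\<dots> \<le> - \<bar>x k\<bar> + (\<Sum>j\<in>top_set n - {k}. \<bar>x j\<bar>)"
    using v(1) by (intro add_mono sum_mono signed_mult_le) (simp_all add: vk unit_sign_mult_self)
  also have "(\<Sum>j\<in>top_set n - {k}. \<bar>x j\<bar>) = S n - \<bar>x k\<bar>"
    using sum.remove[OF top_set(1) kA, of "\<lambda>j. \<bar>x j\<bar>"] by (simp add: sum_top_set S_def)
  finally show ?thesis using large by linarith
qed

definition norming_vector :: "nat \<Rightarrow> nat \<Rightarrow> real" where
  "norming_vector n = (\<lambda>t. inverse (fund n) * sign_on (top_set n) t)"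

lemma dual_norming_vector:
  "H \<in> gamma_dual w \<Longrightarrow> H (norming_vector n) = H (sign_on (top_set n)) / fund n"
  unfolding norming_vector_def by (subst dual_scale[OF _ sign_top(1)]) (auto simp: divide_inverse mult.commute)

lemma norming_vector:
  assumes "1 \<le> n"
  shows "norming_vector n \<in> gamma w" "gamma_norm w (norming_vector n) \<le> 1"
    and "F (norming_vector n) = S n / fund n"
proof -
  show "norming_vector n \<in> gamma w"
    unfolding norming_vector_def by (rule scale_mem[OF sign_top(1)])
  show "gamma_norm w (norming_vector n) \<le> 1"
    unfolding norming_vector_def N_scale[OF sign_top(1)] sign_top(2) using fund_pos[OF assms] by simp
  show "F (norming_vector n) = S n / fund n"
    unfolding dual_norming_vector[OF F_dual] sign_top(3) ..
qed

text \<open>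
  On all sign patterns but one, \<open>F\<close> is at most \<open>r\<close> times the norm for a fixed \<open>r < 1\<close>; a small perturbation
  keeps their values, relative to the norm, below the one at the exceptional pattern, which is affine in the
  perturbation.
\<close>

lemma smooth_if_strict_maximum:
  assumes n: "1 \<le> n" "S n = fund n"
    and q: "0 \<le> q" "q < 1" "\<And>m. 1 \<le> m \<Longrightarrow> m \<noteq> n \<Longrightarrow> S m \<le> q * fund m"
  shows "smooth_point (gamma_dual w) (gamma_dual_norm w) F"
proof -
  let ?v = "sign_on (top_set n)"
  have fn: "0 < fund n" using fund_pos[OF n(1)] .
  define e where "e = \<bar>x (enum (n - 1))\<bar> - \<bar>x (enum n)\<bar>"
  have drop: "\<bar>x (enum n)\<bar> < \<bar>x (enum (n - 1))\<bar>"
    using n q(2) q(3)[of "Suc n"] by (intro drop_at_strict_maximum[of n q]) auto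
  define r where "r = max q (1 - e / fund n)"
  have r: "0 \<le> r" "r < 1" "q \<le> r" "1 - e / fund n \<le> r"
    using q drop fn by (auto simp: r_def e_def)
  have gap: "F v \<le> r * gamma_norm w v" if v: "v \<in> gamma w" "signed v" "v \<noteq> ?v" for v
  proof (cases "finite (support v)")
    case False
    have "F v \<le> q * gamma_norm w v"
      using v q(3) n by (intro F_infinite_signed_le[OF v(2) False v(1) q(1), of n]) auto
    also have "\<dots> \<le> r * gamma_norm w v" using r gamma_norm_nonneg by (intro mult_right_mono)
    finally show ?thesis .
  next
    case True
    note norm = signed_finite(3)[OF v(2) True]
    show ?thesis
    proof (cases "card (support v) = n")
      case False
      have "F v \<le> S (card (support v))" using v True by (intro F_signed_le_S)
      also have "\<dots> \<le> q * fund (card (support v))"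
        using q(3)[OF _ False] by (cases "card (support v)") (auto simp: S_0)
      also have "\<dots> \<le> r * fund (card (support v))" using r fund_nonneg by (intro mult_right_mono)
      finally show ?thesis unfolding norm .
    next
      case card: True
      have "F v \<le> fund n - e"
        using F_signed_gap[OF n(1) v(2) True card v(1,3) drop] by (simp add: n(2) e_def)
      also have "\<dots> = (1 - e / fund n) * fund n" using fn by (simp add: field_simps)
      also have "\<dots> \<le> r * fund n" using r fn by (intro mult_right_mono) auto
      finally show ?thesis unfolding norm card .
    qed
  qed
  show ?thesis
  proof (rule smooth_if_locally_linear_bound[OF F])
    let ?u = "norming_vector n"
    show u: "?u \<in> gamma w" "gamma_norm w ?u \<le> 1" by (rule norming_vector[OF n(1)])+
    show "F ?u = 1" using fn n by (simp add: norming_vector)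
    fix H assume H: "H \<in> gamma_dual w"
    define h where "h = gamma_dual_norm w H"
    have h: "0 \<le> h" unfolding h_def by (rule dual_norm_nonneg[OF H])
    have Hle: "\<bar>H v\<bar> \<le> h * gamma_norm w v" if "v \<in> gamma w" for v
      unfolding h_def using abs_le_dual_norm[OF H that] .
    \<comment> \<open>Half of the gap \<open>1 - r\<close> is spent on the perturbation at the other sign patterns, half on
      its effect at the exceptional one.\<close>
    define t where "t = (1 - r) / (2 * h + 2)"
    have t: "0 < t" using r h by (simp add: t_def)
    have th: "t * h \<le> (1 - r) / 2"
      using r h by (simp add: t_def field_simps)
    have "gamma_dual_norm w (\<lambda>u. F u + s * H u) \<le> 1 + s * H ?u" if s: "s \<in> {t, - t}" for s
    proof -
      have abs_s: "\<bar>s\<bar> = t" using s t by auto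
      have "\<bar>s * H ?u\<bar> \<le> t * h"
        using Hle[OF u(1)] mult_left_mono[OF u(2) h] t
        by (auto simp: abs_mult abs_s intro!: mult_left_mono)
      then have K: "(1 + r) / 2 \<le> 1 + s * H ?u" using th by (simp add: field_simps)
      show ?thesis
      proof (rule dual_norm_le_if_le_on_signed)
        show "(\<lambda>u. F u + s * H u) \<in> gamma_dual w" using dual_comb_mem[OF F_dual H, of 1 s] by simp
        show "0 \<le> 1 + s * H ?u" using K r(1) by simp
        fix v assume v: "v \<in> gamma w" "signed v"
        show "F v + s * H v \<le> (1 + s * H ?u) * gamma_norm w v"
        proof (cases "v = ?v")
          case True
          then show ?thesis
            using fn n(2) by (simp add: sign_top dual_norming_vector[OF H] field_simps)
        next
          case False
          have "s * H v \<le> \<bar>s\<bar> * \<bar>H v\<bar>" by (simp add: abs_mult[symmetric])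
          also have "\<dots> \<le> t * (h * gamma_norm w v)" using t v by (simp add: abs_s Hle)
          also have "\<dots> \<le> (1 - r) / 2 * gamma_norm w v"
            using mult_right_mono[OF th gamma_norm_nonneg[of v]] by (simp add: mult.assoc)
          finally have "F v + s * H v \<le> r * gamma_norm w v + (1 - r) / 2 * gamma_norm w v"
            using gap[OF v False] by linarith
          also have "\<dots> = (1 + r) / 2 * gamma_norm w v" by (simp add: field_simps)
          also have "\<dots> \<le> (1 + s * H ?u) * gamma_norm w v"
            using K gamma_norm_nonneg by (intro mult_right_mono)
          finally show ?thesis .
        qed
      qed
    qed
    then show "\<exists>t>0. \<forall>s\<in>{t, - t}. gamma_dual_norm w (\<lambda>u. F u + s * H u) \<le> 1 + s * H ?u"
      using t by blast
  qed
qed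

section \<open>Several norming sequences destroy smoothness\<close>

text \<open>
  The two sign patterns are separated by the coordinate at an index in the larger top set only.
\<close>

lemma not_smooth_if_two_maxima:
  assumes "1 \<le> m" "m < n" "S m = fund m" "S n = fund n"
  shows "\<not> smooth_point (gamma_dual w) (gamma_dual_norm w) F"
proof -
  let ?p = "enum m"
  let ?H = "\<lambda>u. if u \<in> gamma w then u ?p else 0"
  have pos: "0 < fund m" "0 < fund n" using assms by (auto intro: fund_pos)
  have H: "?H \<in> gamma_dual w"
    by (rule restricted_functional_in_dual[of _ "1 / tail 0"]) (use coordinate_bound in auto)
  have "?p \<notin> top_set m" "?p \<in> top_set n"
    using assms(2) inj_enum by (auto simp: top_set_def inj_eq)
  then have Hm: "?H (norming_vector m) = 0" and Hn: "\<bar>?H (norming_vector n)\<bar> = inverse (fund n)"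
    using assms(1,2) pos norming_vector(1)[of m] norming_vector(1)[of n]
    by (auto simp: norming_vector_def sign_on_def abs_mult abs_unit_sign)
  have "0 < \<bar>?H (norming_vector n)\<bar>" unfolding Hn using pos by simp
  then have ne: "?H (norming_vector m) \<noteq> ?H (norming_vector n)" unfolding Hm by (metis abs_zero less_irrefl)
  show ?thesis
  proof (rule not_smooth_if_two_norming_sequences[OF F])
    show "(\<lambda>_. F (norming_vector m)) \<longlonglongrightarrow> 1" "(\<lambda>_. F (norming_vector n)) \<longlonglongrightarrow> 1"
      using assms pos by (simp_all add: norming_vector)
    show "(\<lambda>_. ?H (norming_vector m)) \<longlonglongrightarrow> ?H (norming_vector m)"
      "(\<lambda>_. ?H (norming_vector n)) \<longlonglongrightarrow> ?H (norming_vector n)" by (rule tendsto_const)+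
  qed (use norming_vector(1,2) assms ne H in simp_all)
qed

text \<open>
  \<open>R k\<close> is any requirement on consecutive terms that all sufficiently large successors meet; it is used to make
  the subsequence as sparse as desired.
\<close>

lemma norming_subsequence:
  assumes freq: "\<And>q N. q < 1 \<Longrightarrow> \<exists>n>N. q * fund n < S n"
    and R: "\<And>k n. \<exists>N. \<forall>n'\<ge>N. R k n n'"
  shows "\<exists>\<nu> :: nat \<Rightarrow> nat. strict_mono \<nu> \<and> (\<forall>k. 1 \<le> \<nu> k) \<and>
    (\<forall>k. (1 - 1 / real (Suc k)) * fund (\<nu> k) \<le> S (\<nu> k)) \<and> (\<forall>k. R k (\<nu> k) (\<nu> (Suc k)))"
proof -
  let ?P = "\<lambda>k n. 1 \<le> n \<and> (1 - 1 / real (Suc k)) * fund n \<le> S n"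
  have ex: "\<exists>n. ?P k n \<and> N < n" for k N
  proof -
    have "1 - 1 / real (Suc k) < 1" by simp
    from freq[OF this, of N] obtain n where "N < n" "(1 - 1 / real (Suc k)) * fund n < S n" by blast
    then show ?thesis by (intro exI[of _ n]) (simp add: less_imp_le Suc_le_eq)
  qed
  have "\<exists>\<nu>. \<forall>k. ?P k (\<nu> k) \<and> (\<nu> k < \<nu> (Suc k) \<and> R k (\<nu> k) (\<nu> (Suc k)))"
  proof (rule dependent_nat_choice)
    show "\<exists>n. ?P 0 n" using ex by blast
    fix n k
    obtain N where N: "\<forall>n'\<ge>N. R k n n'" using R by blast
    obtain n' where "?P (Suc k) n'" "max n N < n'" using ex by blast
    then show "\<exists>n'. ?P (Suc k) n' \<and> n < n' \<and> R k n n'" using N by (intro exI[of _ n']) auto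
  qed
  then show ?thesis unfolding strict_mono_Suc_iff by blast
qed

lemma ratio_tendsto_1:
  assumes "\<And>k. 1 \<le> \<nu> k" "\<And>k. (1 - 1 / real (Suc k)) * fund (\<nu> k) \<le> S (\<nu> k)"
  shows "(\<lambda>k. S (\<nu> k) / fund (\<nu> k)) \<longlonglongrightarrow> 1"
proof (rule tendsto_sandwich)
  have pos: "0 < fund (\<nu> k)" for k using assms(1) by (rule fund_pos)
  show "eventually (\<lambda>k. 1 - 1 / real (Suc k) \<le> S (\<nu> k) / fund (\<nu> k)) sequentially"
    using pos assms(2) by (simp add: pos_le_divide_eq)
  show "eventually (\<lambda>k. S (\<nu> k) / fund (\<nu> k) \<le> 1) sequentially"
    using pos S_le_fund by (simp add: pos_divide_le_eq)
  show "(\<lambda>k. 1 - 1 / real (Suc k)) \<longlonglongrightarrow> 1"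
    using tendsto_diff[OF tendsto_const LIMSEQ_inverse_real_of_nat, of 1] by (simp add: inverse_eq_divide)
qed simp

text \<open>
  The infinite sign pattern \<open>v\<close> of \<open>x\<close> lies in \<open>\<gamma>\<close>, its norm is the limit of \<open>fund\<close>, and \<open>F v\<close> dominates all
  \<open>S n\<close>, so it is norming after normalization. The generalized limit of \<open>v k * u k\<close> vanishes on the finite sign
  patterns but not on \<open>v\<close>.
\<close>

lemma not_smooth_if_fund_bounded:
  assumes freq: "\<And>q N. q < 1 \<Longrightarrow> \<exists>n>N. q * fund n < S n"
    and bdd: "\<And>n. fund n \<le> C"
  shows "\<not> smooth_point (gamma_dual w) (gamma_dual_norm w) F"
proof -
  obtain \<nu> where \<nu>: "strict_mono \<nu>" "\<And>k. 1 \<le> \<nu> k"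
    "\<And>k. (1 - 1 / real (Suc k)) * fund (\<nu> k) \<le> S (\<nu> k)"
    using norming_subsequence[OF freq, of "\<lambda>_ _ _. True"] by auto
  obtain \<Phi> where \<Phi>: "fund \<longlonglongrightarrow> \<Phi>" "\<And>n. fund n \<le> \<Phi>"
    using incseq_convergent[of fund C] bdd fund_mono by (auto simp: incseq_def)
  have \<Phi>_pos: "0 < \<Phi>" using fund_pos[of 1] \<Phi>(2)[of 1] by simp
  define v where "v = sign_on {1..}"
  have v: "v \<in> gamma w" "gamma_norm w v \<le> \<Phi>"
    using \<Phi>_pos \<Phi>(2) bounded_sequence_in_gamma[of \<Phi> v] by (auto simp: v_def sign_on_def unit_sign_def)
  have "S n \<le> F v" for n
  proof -
    have vx: "v k * x k = \<bar>x k\<bar>" for k by (simp add: v_def sign_on_def unit_sign_mult_self x_0 Suc_le_eq)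
    have "S n = (\<Sum>k\<in>top_set n. v k * x k)" unfolding vx by (simp add: sum_top_set S_def)
    also have "\<dots> \<le> (\<Sum>k. v k * x k)"
      using pairing[OF v(1)] by (intro sum_le_suminf top_set) (auto simp: vx sums_iff)
    also have "\<dots> = F v" using pairing[OF v(1)] by (simp add: sums_iff)
    finally show ?thesis .
  qed
  then have "(1 - 1 / real (Suc k)) * fund (\<nu> k) \<le> F v" for k using \<nu>(3) order_trans by blast
  moreover have "(\<lambda>k. (1 - 1 / real (Suc k)) * fund (\<nu> k)) \<longlonglongrightarrow> (1 - 0) * \<Phi>"
    using LIMSEQ_inverse_real_of_nat LIMSEQ_subseq_LIMSEQ[OF \<Phi>(1) \<nu>(1)]
    by (intro tendsto_intros) (simp_all add: inverse_eq_divide comp_def)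
  ultimately have "\<Phi> \<le> F v" by (intro LIMSEQ_le_const2[of _ "\<Phi>" "F v"]) auto
  then have Fv: "F v = \<Phi>" using F_le[OF v(1)] v(2) by simp
  let ?u = "\<lambda>t. inverse \<Phi> * v t"
  have u: "?u \<in> gamma w" "gamma_norm w ?u \<le> 1" "F ?u = 1"
    using v(2) \<Phi>_pos Fv scale_mem[OF v(1)]
    by (simp_all add: N_scale[OF v(1)] dual_scale[OF F_dual v(1)]) (simp add: field_simps)
  obtain L where "limit_functional L" using limit_functional_exists by blast
  note L = this[unfolded limit_functional_def, THEN conjunct1, rule_format]
    this[unfolded limit_functional_def, THEN conjunct2, THEN conjunct1, rule_format]
    this[unfolded limit_functional_def, THEN conjunct2, THEN conjunct2, rule_format]
  let ?H = "\<lambda>u. if u \<in> gamma w then L (\<lambda>k. v k * u k) else 0"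
  have bd: "\<bar>v k * u k\<bar> \<le> 1 / tail 0 * gamma_norm w u" if "u \<in> gamma w" for u k
    using coordinate_bound[OF that, of k] gamma_norm_nonneg[of u] tail_nonneg
    by (auto simp: v_def sign_on_def abs_mult abs_unit_sign)
  have bs: "Bseq (\<lambda>k. v k * u k)" if "u \<in> gamma w" for u
    using bd[OF that] by (intro BseqI') auto
  have H: "?H \<in> gamma_dual w"
  proof (rule restricted_functional_in_dual[where C = "1 / tail 0"])
    fix u u' a b assume "u \<in> gamma w" "u' \<in> gamma w"
    then show "L (\<lambda>k. v k * (a * u k + b * u' k)) = a * L (\<lambda>k. v k * u k) + b * L (\<lambda>k. v k * u' k)"
      using L(1)[OF bs bs, of u u' a b] by (simp add: algebra_simps)
  next
    show "\<bar>L (\<lambda>k. v k * u k)\<bar> \<le> 1 / tail 0 * gamma_norm w u" if "u \<in> gamma w" for u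
      using bd[OF that] by (rule L(2))
  qed
  have "(\<lambda>k. v k * ?u k) \<longlonglongrightarrow> inverse \<Phi>"
    by (rule tendsto_eventually, rule eventually_mono[OF eventually_ge_at_top[of 1]])
      (auto simp: v_def sign_on_def unit_sign_def)
  then have Hu: "?H ?u = inverse \<Phi>" using u(1) by (simp add: L(3))
  have Hv: "?H (norming_vector n) = 0" for n
  proof -
    have "(\<lambda>k. v k * norming_vector n k) \<longlonglongrightarrow> 0"
      by (rule tendsto_eventually, rule eventually_mono[OF eventually_gt_at_top[of "Max (top_set n)"]])
        (use Max_ge[OF top_set(1)[of n]] in \<open>fastforce simp: norming_vector_def sign_on_def\<close>)
    then show ?thesis by (simp add: L(3))
  qed
  show ?thesis
  proof (rule not_smooth_if_two_norming_sequences[OF F])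
    show "(\<lambda>k. F (norming_vector (\<nu> k))) \<longlonglongrightarrow> 1"
      using ratio_tendsto_1[OF \<nu>(2,3)] norming_vector(3)[OF \<nu>(2)] by simp
    show "(\<lambda>k. F ?u) \<longlonglongrightarrow> 1" unfolding u(3) by simp
    show "(\<lambda>k. ?H (norming_vector (\<nu> k))) \<longlonglongrightarrow> 0" unfolding Hv by simp
    show "(\<lambda>k. ?H ?u) \<longlonglongrightarrow> inverse \<Phi>" unfolding Hu by simp
  qed (use norming_vector(1,2)[OF \<nu>(2)] u H \<Phi>_pos in auto)
qed

end

context dual_sequence
begin

text \<open>
  Along a subsequence \<open>\<nu>\<close> on which \<open>fund\<close> grows fast, almost all of \<open>S (\<nu> k)\<close> comes from the indices between
  \<open>\<nu> (k - 1)\<close> and \<open>\<nu> k\<close>. Restrict \<open>F\<close> to the blocks that end at odd positions: the restriction tends to 1 along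
  the norming vectors at odd positions and to 0 along those at even positions.
\<close>

lemma not_smooth_if_fund_unbounded:
  assumes freq: "\<And>q N. q < 1 \<Longrightarrow> \<exists>n>N. q * fund n < S n"
    and unb: "\<And>C. \<exists>n. C < fund n"
  shows "\<not> smooth_point (gamma_dual w) (gamma_dual_norm w) F"
proof -
  have "\<exists>N. \<forall>n'\<ge>N. real (Suc k) * fund n \<le> fund n'" for k n
  proof -
    obtain N where "real (Suc k) * fund n < fund N" using unb by blast
    then show ?thesis using fund_mono by (meson less_imp_le order_trans)
  qed
  note R = this
  obtain \<nu> where \<nu>: "strict_mono \<nu>" "\<And>k. 1 \<le> \<nu> k"
    "\<And>k. (1 - 1 / real (Suc k)) * fund (\<nu> k) \<le> S (\<nu> k)"
    "\<And>k. real (Suc k) * fund (\<nu> k) \<le> fund (\<nu> (Suc k))"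
    using norming_subsequence[OF freq, of "\<lambda>k n n'. real (Suc k) * fund n \<le> fund n'", OF _ R] by blast
  have pos: "0 < fund (\<nu> k)" for k using \<nu>(2) by (rule fund_pos)
  \<comment> \<open>Ranks in the enumeration, not positions of the sequence \<open>x\<close>.\<close>
  define I where "I = (\<Union>k. {\<nu> (2 * k)..<\<nu> (2 * k + 1)})"
  \<comment> \<open>\<open>\<gamma>\<close> is solid, so restricting a sequence to a set of indices is a contraction.\<close>
  let ?r = "\<lambda>u t. if t \<in> enum ` I then u t else 0"
  let ?H = "\<lambda>u. if u \<in> gamma w then F (?r u) else 0"
  have r: "?r u \<in> gamma w" "gamma_norm w (?r u) \<le> gamma_norm w u" if "u \<in> gamma w" for u
    using gamma_solid[OF that, of "?r u"] that by (auto simp: mem_gamma_iff)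
  have H: "?H \<in> gamma_dual w"
  proof (rule restricted_functional_in_dual[of _ 1])
    fix u v a b assume uv: "u \<in> gamma w" "v \<in> gamma w"
    have "?r (\<lambda>t. a * u t + b * v t) = (\<lambda>t. a * ?r u t + b * ?r v t)" by auto
    then show "F (?r (\<lambda>t. a * u t + b * v t)) = a * F (?r u) + b * F (?r v)"
      using dual_comb[OF F_dual r(1) r(1)] uv by simp
  next
    show "\<bar>F (?r u)\<bar> \<le> 1 * gamma_norm w u" if "u \<in> gamma w" for u
      using F_le[OF r(1)[OF that]] r(2)[OF that] by linarith
  qed
  have Hn: "?H (norming_vector n) = (\<Sum>i\<in>{..<n} \<inter> I. \<bar>x (enum i)\<bar>) / fund n" if n: "1 \<le> n" for n
  proof -
    have "?H (norming_vector n) = F (?r (norming_vector n))"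
      using norming_vector(1)[OF n] by simp
    also have "\<dots> = (\<Sum>k\<in>top_set n. ?r (norming_vector n) k * x k)"
      using norming_vector(1)[OF n] top_set(1)
      by (intro pairing_finite r) (auto simp: norming_vector_def sign_on_def)
    also have "\<dots> = (\<Sum>i<n. if i \<in> I then inverse (fund n) * \<bar>x (enum i)\<bar> else 0)"
      unfolding sum_top_set
      by (intro sum.cong refl) (auto simp: norming_vector_def sign_on_def top_set_def
          unit_sign_mult_self inj_image_mem_iff[OF inj_enum] mult.assoc)
    also have "\<dots> = (\<Sum>i\<in>{..<n} \<inter> I. inverse (fund n) * \<bar>x (enum i)\<bar>)"
      by (rule sum.inter_restrict[symmetric]) simp
    finally show ?thesis by (simp add: sum_distrib_left[symmetric] divide_inverse)
  qed
  have lim1: "(\<lambda>k. ?H (norming_vector (\<nu> (2 * k + 1)))) \<longlonglongrightarrow> 1"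
  proof (rule tendsto_sandwich)
    let ?n = "\<lambda>k. \<nu> (2 * k + 1)"
    have "1 - 2 * (1 / real (Suc k)) \<le> ?H (norming_vector (?n k)) \<and> ?H (norming_vector (?n k)) \<le> 1" for k
    proof
      let ?s = "\<Sum>i\<in>{..<?n k} \<inter> I. \<bar>x (enum i)\<bar>"
      have "?s \<le> S (?n k)" unfolding S_def by (intro sum_mono2) auto
      also have "\<dots> \<le> fund (?n k)" by (rule S_le_fund)
      finally show "?H (norming_vector (?n k)) \<le> 1"
        unfolding Hn[OF \<nu>(2)] using pos by (simp add: pos_divide_le_eq)
      have lt: "\<nu> (2 * k) < ?n k" using \<nu>(1) by (simp add: strict_mono_def)
      have "S (?n k) - S (\<nu> (2 * k)) = (\<Sum>i\<in>{\<nu> (2 * k)..<?n k}. \<bar>x (enum i)\<bar>)"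
        using lt sum_diff_nat_ivl[of 0 "\<nu> (2 * k)" "?n k" "\<lambda>i. \<bar>x (enum i)\<bar>"]
        by (simp add: S_def atLeast0LessThan)
      also have "\<dots> \<le> ?s" by (intro sum_mono2) (auto simp: I_def)
      finally have s: "S (?n k) - S (\<nu> (2 * k)) \<le> ?s" .
      have "1 / real (Suc (2 * k + 1)) * fund (?n k) \<le> 1 / real (Suc k) * fund (?n k)"
        using pos[of "2 * k + 1"] by (intro mult_right_mono divide_left_mono) auto
      then have 1: "(1 - 1 / real (Suc k)) * fund (?n k) \<le> S (?n k)"
        using \<nu>(3)[of "2 * k + 1"] unfolding left_diff_distrib mult_1 by linarith
      have "real (Suc k) * S (\<nu> (2 * k)) \<le> real (Suc (2 * k)) * fund (\<nu> (2 * k))"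
        using S_le_fund S_nonneg by (intro mult_mono) auto
      also have "\<dots> \<le> fund (?n k)" using \<nu>(4)[of "2 * k"] by simp
      finally have 2: "S (\<nu> (2 * k)) \<le> 1 / real (Suc k) * fund (?n k)"
        by (simp add: pos_le_divide_eq mult.commute)
      have "(1 - 2 * c) * f = (1 - c) * f - c * f" for c f :: real
        by (simp add: algebra_simps)
      then have "(1 - 2 * (1 / real (Suc k))) * fund (?n k) \<le> ?s" using s 1 2 by (smt (verit))
      then show "1 - 2 * (1 / real (Suc k)) \<le> ?H (norming_vector (?n k))"
        unfolding Hn[OF \<nu>(2)] using pos by (simp add: pos_le_divide_eq)
    qed
    then show "eventually (\<lambda>k. 1 - 2 * (1 / real (Suc k)) \<le> ?H (norming_vector (?n k))) sequentially"
      "eventually (\<lambda>k. ?H (norming_vector (?n k)) \<le> 1) sequentially" by auto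
    show "(\<lambda>k. 1 - 2 * (1 / real (Suc k))) \<longlonglongrightarrow> 1"
      using tendsto_diff[OF tendsto_const tendsto_mult[OF tendsto_const LIMSEQ_inverse_real_of_nat], of 1 2]
      by (simp add: inverse_eq_divide)
  qed simp
  have lim0: "(\<lambda>k. ?H (norming_vector (\<nu> (2 * k + 2)))) \<longlonglongrightarrow> 0"
  proof (rule tendsto_sandwich)
    let ?n = "\<lambda>k. \<nu> (2 * k + 2)"
    have "0 \<le> ?H (norming_vector (?n k)) \<and> ?H (norming_vector (?n k)) \<le> inverse (real (Suc k))" for k
    proof
      let ?s = "\<Sum>i\<in>{..<?n k} \<inter> I. \<bar>x (enum i)\<bar>"
      show "0 \<le> ?H (norming_vector (?n k))"
        unfolding Hn[OF \<nu>(2)] using fund_nonneg by (intro divide_nonneg_nonneg sum_nonneg) auto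
      have "{..<?n k} \<inter> I \<subseteq> {..<\<nu> (2 * k + 1)}"
      proof
        fix i assume "i \<in> {..<?n k} \<inter> I"
        then obtain j where j: "\<nu> (2 * j) \<le> i" "i < \<nu> (2 * j + 1)" "i < ?n k" by (auto simp: I_def)
        then have "\<nu> (2 * j) < ?n k" by linarith
        then have "2 * j < 2 * k + 2" using strict_mono_less[OF \<nu>(1)] by blast
        then have "\<nu> (2 * j + 1) \<le> \<nu> (2 * k + 1)" by (subst strict_mono_less_eq[OF \<nu>(1)]) simp
        then show "i \<in> {..<\<nu> (2 * k + 1)}" using j by simp
      qed
      then have "?s \<le> S (\<nu> (2 * k + 1))" unfolding S_def by (intro sum_mono2) auto
      also have "\<dots> \<le> fund (\<nu> (2 * k + 1))" by (rule S_le_fund)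
      finally have "real (Suc k) * ?s \<le> real (Suc (2 * k + 1)) * fund (\<nu> (2 * k + 1))"
        by (intro mult_mono) (auto intro: sum_nonneg)
      also have "\<dots> \<le> fund (?n k)" using \<nu>(4)[of "2 * k + 1"] by simp
      finally show "?H (norming_vector (?n k)) \<le> inverse (real (Suc k))"
        unfolding Hn[OF \<nu>(2)] using pos[of "2 * k + 2"]
        by (simp add: pos_divide_le_eq inverse_eq_divide pos_le_divide_eq mult.commute)
    qed
    then show "eventually (\<lambda>k. 0 \<le> ?H (norming_vector (?n k))) sequentially"
      "eventually (\<lambda>k. ?H (norming_vector (?n k)) \<le> inverse (real (Suc k))) sequentially" by auto
    show "(\<lambda>k. inverse (real (Suc k))) \<longlonglongrightarrow> 0" by (rule LIMSEQ_inverse_real_of_nat)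
  qed simp
  have sub: "(\<lambda>k. F (norming_vector (\<nu> (f k)))) \<longlonglongrightarrow> 1" if "strict_mono f" for f
    using LIMSEQ_subseq_LIMSEQ[OF ratio_tendsto_1[OF \<nu>(2,3)] that] norming_vector(3)[OF \<nu>(2)]
    by (simp add: comp_def)
  show ?thesis
    by (rule not_smooth_if_two_norming_sequences[OF F _ _ sub _ _ sub H lim1 lim0])
      (auto simp: norming_vector(1,2)[OF \<nu>(2)] strict_mono_Suc_iff)
qed

text \<open>
  Beyond \<open>N\<close> the ratio is at most \<open>q\<close>; the finitely many remaining ratios on \<open>X\<close> are below 1.
\<close>

lemma uniform_gap:
  assumes q: "q < 1" "\<And>n. N < n \<Longrightarrow> S n \<le> q * fund n"
    and X: "\<And>n. n \<in> X \<Longrightarrow> 1 \<le> n" "\<And>n. n \<in> X \<Longrightarrow> S n \<noteq> fund n"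
  obtains r where "0 \<le> r" "r < 1" "\<And>n. n \<in> X \<Longrightarrow> S n \<le> r * fund n"
proof -
  let ?Q = "insert (max 0 q) ((\<lambda>n. S n / fund n) ` (X \<inter> {..N}))"
  have fin: "finite ?Q" by simp
  have "Max ?Q < 1"
  proof -
    have "S n / fund n < 1" if "n \<in> X" for n
      using fund_pos[OF X(1)[OF that]] X(2)[OF that] S_le_fund[of n] by simp
    then show ?thesis using q(1) by (subst Max_less_iff) auto
  qed
  moreover have "max 0 q \<le> Max ?Q" by (rule Max_ge[OF fin]) simp
  moreover have "S n \<le> Max ?Q * fund n" if n: "n \<in> X" for n
  proof (cases "n \<le> N")
    case True
    then have "S n / fund n \<le> Max ?Q" using n by (intro Max_ge[OF fin]) auto
    then show ?thesis using fund_pos[OF X(1)[OF n]] by (simp add: pos_divide_le_eq)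
  next
    case False
    then have "S n \<le> q * fund n" using q(2) by simp
    also have "\<dots> \<le> Max ?Q * fund n"
      using \<open>max 0 q \<le> Max ?Q\<close> fund_nonneg by (intro mult_right_mono) auto
    finally show ?thesis .
  qed
  ultimately show ?thesis using that[of "Max ?Q"] by simp
qed

section \<open>The characterization\<close>

text \<open>
  If \<open>F\<close> is smooth, the ratio cannot come close to 1 along arbitrarily large \<open>n\<close>, nor equal 1 twice; since its
  supremum is 1, it is attained exactly once.
\<close>

lemma smooth_iff_strict_maximum:
  "smooth_point (gamma_dual w) (gamma_dual_norm w) F \<longleftrightarrow>
    (\<exists>n\<ge>1. S n = fund n \<and> (\<exists>q. 0 \<le> q \<and> q < 1 \<and> (\<forall>m\<ge>1. m \<noteq> n \<longrightarrow> S m \<le> q * fund m)))"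
proof
  assume smooth: "smooth_point (gamma_dual w) (gamma_dual_norm w) F"
  have "\<exists>q N. q < 1 \<and> (\<forall>n>N. S n \<le> q * fund n)"
  proof (rule ccontr)
    assume "\<not> ?thesis"
    then have freq: "\<exists>n>N. q * fund n < S n" if "q < 1" for q N using that by (meson not_less)
    show False
    proof (cases "\<exists>C. \<forall>n. fund n \<le> C")
      case True
      then show False using not_smooth_if_fund_bounded[OF freq] smooth by blast
    next
      case False
      then show False using not_smooth_if_fund_unbounded[OF freq] smooth by (meson not_less)
    qed
  qed
  then obtain q N where q: "q < 1" "\<And>n. N < n \<Longrightarrow> S n \<le> q * fund n" by blast
  have "\<exists>n\<ge>1. S n = fund n"
  proof (rule ccontr)
    assume none: "\<not> ?thesis"
    obtain r where "0 \<le> r" "r < 1" "\<And>n. n \<in> {1..} \<Longrightarrow> S n \<le> r * fund n"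
      by (rule uniform_gap[OF q, where X = "{1..}"]) (use none in auto)
    then show False using sup_ratio_ge_1[of r] by force
  qed
  then obtain n where n: "1 \<le> n" "S n = fund n" by blast
  have "S m \<noteq> fund m" if "1 \<le> m" "m \<noteq> n" for m
    using not_smooth_if_two_maxima[of m n] not_smooth_if_two_maxima[of n m] smooth n that
    by (cases m n rule: linorder_cases) auto
  then have ne: "S m \<noteq> fund m" if "m \<in> {1..} - {n}" for m using that by auto
  obtain r where "0 \<le> r" "r < 1" "\<And>m. m \<in> {1..} - {n} \<Longrightarrow> S m \<le> r * fund m"
    by (rule uniform_gap[OF q, where X = "{1..} - {n}"]) (use ne in auto)
  then show "\<exists>n\<ge>1. S n = fund n \<and> (\<exists>q. 0 \<le> q \<and> q < 1 \<and> (\<forall>m\<ge>1. m \<noteq> n \<longrightarrow> S m \<le> q * fund m))"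
    using n by (intro exI[of _ n] conjI exI[of _ r]) auto
qed (use smooth_if_strict_maximum in blast)

lemma SUP_less_1_iff:
  assumes "X \<subseteq> {1..}"
  shows "(SUP n\<in>X. max_rearr x n * psi w n) < 1 \<longleftrightarrow> (\<exists>q. 0 \<le> q \<and> q < 1 \<and> (\<forall>n\<in>X. S n \<le> q * fund n))"
proof -
  have eq: "max_rearr x n * psi w n \<le> ennreal q \<longleftrightarrow> S n \<le> q * fund n" if "n \<in> X" "0 \<le> q" for n q
  proof -
    have n: "1 \<le> n" using that assms by auto
    show ?thesis
      unfolding max_rearr_psi[OF n] using that(2) fund_pos[OF n] by (simp add: pos_divide_le_eq)
  qed
  show ?thesis
  proof
    assume *: "(SUP n\<in>X. max_rearr x n * psi w n) < 1"
    then obtain q where q: "0 \<le> q" "(SUP n\<in>X. max_rearr x n * psi w n) = ennreal q"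
      by (cases "SUP n\<in>X. max_rearr x n * psi w n") auto
    have "S n \<le> q * fund n" if "n \<in> X" for n
      unfolding eq[OF that q(1), symmetric] q(2)[symmetric] using that by (rule SUP_upper)
    then show "\<exists>q. 0 \<le> q \<and> q < 1 \<and> (\<forall>n\<in>X. S n \<le> q * fund n)" using q * by auto
  next
    assume "\<exists>q. 0 \<le> q \<and> q < 1 \<and> (\<forall>n\<in>X. S n \<le> q * fund n)"
    then obtain q where q: "0 \<le> q" "q < 1" "\<And>n. n \<in> X \<Longrightarrow> S n \<le> q * fund n" by blast
    then have "(SUP n\<in>X. max_rearr x n * psi w n) \<le> ennreal q" by (intro SUP_least) (simp add: eq)
    also have "\<dots> < 1" using q by simp
    finally show "(SUP n\<in>X. max_rearr x n * psi w n) < 1" .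
  qed
qed

end

theorem theorem6p5:
  fixes w x :: "nat \<Rightarrow> real" and F :: "(nat \<Rightarrow> real) \<Rightarrow> real"
  assumes "nonneg_weight w"
    and "F \<in> unit_sphere (gamma_dual w) (gamma_dual_norm w)"
    and "given_by (gamma w) F x"
  shows "smooth_point (gamma_dual w) (gamma_dual_norm w) F \<longleftrightarrow>
    (\<exists>n0\<ge>1. max_rearr x n0 * psi w n0 = 1 \<and>
            (SUP n\<in>{1..} - {n0}. max_rearr x n * psi w n) < 1)"
proof -
  interpret dual_sequence w F x by unfold_locales (rule assms)+
  have "max_rearr x n * psi w n = 1 \<longleftrightarrow> S n = fund n" if n: "1 \<le> n" for n
    unfolding max_rearr_psi[OF n] using fund_pos[OF n] by auto
  moreover have "(SUP m\<in>{1..} - {n}. max_rearr x m * psi w m) < 1 \<longleftrightarrow>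
      (\<exists>q. 0 \<le> q \<and> q < 1 \<and> (\<forall>m\<ge>1. m \<noteq> n \<longrightarrow> S m \<le> q * fund m))" for n
    by (subst SUP_less_1_iff) auto
  ultimately show ?thesis unfolding smooth_iff_strict_maximum by blast
qed

end
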